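(* Let $n$ be a positive integer. Let $\mathbf H=(H_1,\dots,H_{2n})$ be a $2n$-tuple of non-empty subsets of $\{+,-\}$ and let $\mathbf S=(S_1,\dots,S_n)$ be given by $S_i=H_{2i-1}\cap H_{2i}$. Then (i) $$\sum_{\pi\in\mathcal B_{2n}(\mathbf H)}(-1)^{\ell_B(\pi)}t^{\mathrm{fdes}(\pi)}q^{\mathrm{fmaj}(\pi)}\prod_{i\in\mathrm{Neg}(\pi)}x_i= \prod_{i=1}^{n}(1-t^2q^{4i-2}) \sum_{\pi\in\mathcal B_{n}(\mathbf S)}t^{\mathrm{fdes}(\pi)}q^{2\,\mathrm{fmaj}(\pi)}\prod_{i\in\mathrm{Neg}(\pi)}x_{2i-1}x_{2i},$$ (ii) $$\sum_{\pi\in\mathcal B_{2n}(\mathbf H)}(-1)^{\mathrm{inv}(|\pi|)}t^{\mathrm{fdes}(\pi)}q^{\mathrm{fmaj}(\pi)}\prod_{i\in\mathrm{Neg}(\pi)}x_i= \prod_{i=1}^{n}(1-t^2q^{4i-2}) \sum_{\pi\in\mathcal B_{n}(\mathbf S)}t^{\mathrm{fdes}(\pi)}q^{2\,\mathrm{fmaj}(\pi)}\prod_{i\in\mathrm{Neg}(\pi)}x_{2i-1}x_{2i};$$ and, for any $n$-tuple $\mathbf S=(S_1,\dots,S_n)$ of non-empty subsets of $\{+,-\}$, (iii) $$\sum_{\pi\in\mathcal B_{n}(\mathbf S)}(-1)^{\mathrm{neg}(\pi)}t^{\mathrm{fdes}(\pi)}q^{\mathrm{fmaj}(\pi)}\prod_{i\in\mathrm{Neg}(\pi)}x_i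 = \sum_{\pi\in\mathcal B_{n}(\mathbf S)}t^{\mathrm{fdes}(\pi)}(-q)^{\mathrm{fmaj}(\pi)}\prod_{i\in\mathrm{Neg}(\pi)}x_i.$$ In particular, (i) $$\sum_{\pi\in\mathcal B_{2n}}(-1)^{\ell_B(\pi)}t^{\mathrm{fdes}(\pi)}q^{\mathrm{fmaj}(\pi)}x^{\mathrm{neg}(\pi)} = \prod_{i=1}^{n}(1-t^2q^{4i-2}) \sum_{\pi\in\mathcal B_{n}}t^{\mathrm{fdes}(\pi)}q^{2\,\mathrm{fmaj}(\pi)}x^{2\,\mathrm{neg}(\pi)},$$ (ii) $$\sum_{\pi\in\mathcal B_{2n}}(-1)^{\mathrm{inv}(|\pi|)}t^{\mathrm{fdes}(\pi)}q^{\mathrm{fmaj}(\pi)}x^{\mathrm{neg}(\pi)} = \prod_{i=1}^{n}(1-t^2q^{4i-2}) \sum_{\pi\in\mathcal B_{n}}t^{\mathrm{fdes}(\pi)}q^{2\,\mathrm{fmaj}(\pi)}x^{2\,\mathrm{neg}(\pi)},$$ (iii) $$\sum_{\pi\in\mathcal B_{n}}(-1)^{\mathrm{neg}(\pi)}t^{\mathrm{fdes}(\pi)}q^{\mathrm{fmaj}(\pi)}x^{\mathrm{neg}(\pi)} = \sum_{\pi\in\mathcal B_{n}}t^{\mathrm{fdes}(\pi)}(-q)^{\mathrm{fmaj}(\pi)}x^{\mathrm{neg}(\pi)}.$$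
   Context: For $N\ge1$, $\mathcal B_N$ is the group of signed permutations: words $\pi=\pi_1\cdots\pi_N$ with $\pi_i\in\{\pm1,\dots,\pm N\}$ such that $|\pi|:=|\pi_1|\cdots|\pi_N|$ is a permutation of $\{1,\dots,N\}$. Write $\bar i=-i$. $\mathrm{Neg}(\pi)=\{i:\pi_i<0\}$ (a set of positions) and $\mathrm{neg}(\pi)=|\mathrm{Neg}(\pi)|$. $\mathrm{inv}(\pi)=|\{(i,j):i<j,\ \pi_i>\pi_j\}|$ in the natural order of integers (so $\mathrm{inv}(|\pi|)$ is the usual inversion number of $|\pi|$), and $\ell_B(\pi)=\mathrm{inv}(\pi)-\sum_{i\in\mathrm{Neg}(\pi)}\pi_i$. Restricted signed permutations: for an $N$-tuple $\mathbf S=(S_1,\dots,S_N)$ of subsets of $\{+,-\}$, $\mathcal B_N(\mathbf S)$ is the set of $\pi\in\mathcal B_N$ such that the sign of $\pi_i$ belongs to $S_i$ for every $i$ (empty if some $S_i=\emptyset$). Flag statistics: $\mathrm{Des}_F(\pi)=\{i\in\{1,\dots,N-1\}:\pi_i>\pi_{i+1}\}$ with respect to the linear order $\bar1<\bar2<\cdots<\bar N<1<2<\cdots<N$, $\mathrm{des}_F(\pi)=|\mathrm{Des}_F(\pi)|$, $\mathrm{maj}_F(\pi)=\sum_{i\in\mathrm{Des}_F(\pi)}i$, $\mathrm{fdes}(\pi)=2\,\mathrm{des}_F(\pi)+\delta(\pi_1<0)$ (where $\delta(\mathsf A)=1$ if $\mathsf A$ is true and $0$ otherwise), and $\mathrm{fmaj}(\pi)=2\,\mathrm{maj}_F(\pi)+\mathrm{neg}(\pi)$.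 $t,q,x,x_1,x_2,\dots$ are commuting indeterminates. *)

theory Defs
  imports Complex_Main "HOL-Library.FuncSet"
begin

text \<open>
  A word \<open>\<pi>\<^sub>1 \<dots> \<pi>\<^sub>N\<close> is a function on positions, extensional on \<open>{1..N}\<close>. The statistics
  therefore take the length \<open>N\<close> of the word as an argument.
\<close>

definition signed_perms :: "nat \<Rightarrow> (nat \<Rightarrow> int) set" where
  "signed_perms N =
     {\<pi> \<in> {1..N} \<rightarrow>\<^sub>E ({- int N..int N} - {0}). bij_betw (\<lambda>i. \<bar>\<pi> i\<bar>) {1..N} {1..int N}}"

datatype sign = Plus | Minus

definition sign_of :: "int \<Rightarrow> sign" where
  "sign_of a = (if a < 0 then Minus else Plus)"

text \<open>The \<open>N\<close>-tuple \<open>S\<close> is a function of which only the values at \<open>1, \<dots>, N\<close> matter.\<close>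

definition restricted_signed_perms :: "nat \<Rightarrow> (nat \<Rightarrow> sign set) \<Rightarrow> (nat \<Rightarrow> int) set" where
  "restricted_signed_perms N S = {\<pi> \<in> signed_perms N. \<forall>i\<in>{1..N}. sign_of (\<pi> i) \<in> S i}"

definition Neg :: "nat \<Rightarrow> (nat \<Rightarrow> int) \<Rightarrow> nat set" where
  "Neg N \<pi> = {i \<in> {1..N}. \<pi> i < 0}"

definition neg :: "nat \<Rightarrow> (nat \<Rightarrow> int) \<Rightarrow> nat" where
  "neg N \<pi> = card (Neg N \<pi>)"

definition inversions :: "nat \<Rightarrow> (nat \<Rightarrow> int) \<Rightarrow> nat" where
  "inversions N \<pi> = card {(i, j). i \<in> {1..N} \<and> j \<in> {1..N} \<and> i < j \<and> \<pi> i > \<pi> j}"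

text \<open>The argument of \<^const>\<open>nat\<close> is never negative, as only negative letters are subtracted.\<close>

definition length_B :: "nat \<Rightarrow> (nat \<Rightarrow> int) \<Rightarrow> nat" where
  "length_B N \<pi> = nat (int (inversions N \<pi>) - (\<Sum>i\<in>Neg N \<pi>. \<pi> i))"

text \<open>On nonzero integers this is the order \<open>-1 < -2 < -3 < \<dots> < 1 < 2 < 3 < \<dots>\<close>.\<close>

definition flag_less :: "int \<Rightarrow> int \<Rightarrow> bool" where
  "flag_less a b \<longleftrightarrow> (a < 0 \<and> 0 < b) \<or> (sgn a = sgn b \<and> \<bar>a\<bar> < \<bar>b\<bar>)"

definition Des_F :: "nat \<Rightarrow> (nat \<Rightarrow> int) \<Rightarrow> nat set" where
  "Des_F N \<pi> = {i \<in> {1..N - 1}. flag_less (\<pi> (i + 1)) (\<pi> i)}"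

definition des_F :: "nat \<Rightarrow> (nat \<Rightarrow> int) \<Rightarrow> nat" where
  "des_F N \<pi> = card (Des_F N \<pi>)"

definition maj_F :: "nat \<Rightarrow> (nat \<Rightarrow> int) \<Rightarrow> nat" where
  "maj_F N \<pi> = (\<Sum>i\<in>Des_F N \<pi>. i)"

definition fdes :: "nat \<Rightarrow> (nat \<Rightarrow> int) \<Rightarrow> nat" where
  "fdes N \<pi> = 2 * des_F N \<pi> + of_bool (\<pi> 1 < 0)"

definition fmaj :: "nat \<Rightarrow> (nat \<Rightarrow> int) \<Rightarrow> nat" where
  "fmaj N \<pi> = 2 * maj_F N \<pi> + neg N \<pi>"

end

theory Submission
  imports Defs
begin

text \<open>
  The heart of the matter is the sum with the sign of \<open>inv(\<bar>\<pi>\<bar>)\<close>. If the absolute values \<open>2k - 1\<close>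
  and \<open>2k\<close> of a word of length \<open>2n\<close> are exchanged while every position keeps its sign, then
  \<open>inv(\<bar>\<pi>\<bar>)\<close> changes by one, \<open>Neg\<close> does not change, and neither do the flag descents, unless the
  two letters are neighbours of equal sign (\<open>linked\<close> below). So all words cancel in which some
  pair \<open>2k - 1, 2k\<close> is not linked (\<open>sum_eq_sum_all_linked\<close>).

  In a surviving word the linked pairs match each position with a neighbour, and the only way to
  do this is to match \<open>2i - 1\<close> with \<open>2i\<close> (\<open>linked_blocks\<close>). The word is therefore given by a
  signed permutation \<open>\<tau>\<close> of the \<open>n\<close> blocks and the set \<open>F\<close> of blocks whose two letters decrease in
  absolute value; it is called \<open>inflate n \<tau> F\<close> below. The two letters of a block have the same
  sign, which has to be allowed at both positions, so \<open>\<tau>\<close> ranges over the words restricted by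
  \<open>H\<^bsub>2i-1\<^esub> \<inter> H\<^bsub>2i\<^esub>\<close> (\<open>bij_betw_inflate\<close>).

  The flag descents of this word are \<open>2i - 1\<close> for \<open>i \<in> F\<close> and \<open>2i\<close> for the flag descents \<open>i\<close> of
  \<open>\<tau>\<close>, and its sign is \<open>(-1)\<^bsup>|F|\<^esup>\<close>. Each \<open>i \<in> F\<close> thus contributes \<open>- t\<^sup>2 q\<^bsup>4i-2\<^esup>\<close> independently of
  \<open>\<tau>\<close>. Summing over \<open>F\<close> gives the product \<open>\<Prod>(1 - t\<^sup>2 q\<^bsup>4i-2\<^esup>)\<close>, and \<open>\<tau>\<close> contributes
  \<open>t\<^bsup>fdes\<^esup> q\<^bsup>2 fmaj\<^esup>\<close> (\<open>sum_sign_abs\<close>).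

  The sum with the sign of the length reduces to this one. The parities of \<open>length_B\<close> and
  \<open>inv(\<bar>\<pi>\<bar>) + neg(\<pi>)\<close> agree (\<open>sign_length_B\<close>), so the sign of the length amounts to taking
  \<open>- xs i\<close> for \<open>xs i\<close>.

  In the identity with the sign of \<open>neg\<close>, the two sums agree term by term, because \<open>fmaj\<close> and
  \<open>neg\<close> have the same parity by definition. The versions with one variable \<open>x\<close> are those with all
  \<open>xs i = x\<close> and no restriction on signs.
\<close>

section \<open>Signed permutations as functions\<close>

lemma signed_perm_abs_bounds:
  assumes "\<pi> \<in> signed_perms N" "i \<in> {1..N}"
  shows "1 \<le> \<bar>\<pi> i\<bar>" "\<bar>\<pi> i\<bar> \<le> int N"
proof -
  have "\<pi> i \<in> {- int N..int N} - {0}"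
    using assms unfolding signed_perms_def by blast
  then show "1 \<le> \<bar>\<pi> i\<bar>" "\<bar>\<pi> i\<bar> \<le> int N" by auto
qed

lemma signed_perm_abs_inject:
  assumes "\<pi> \<in> signed_perms N" "i \<in> {1..N}" "j \<in> {1..N}" "\<bar>\<pi> i\<bar> = \<bar>\<pi> j\<bar>"
  shows "i = j"
proof -
  have "inj_on (\<lambda>i. \<bar>\<pi> i\<bar>) {1..N}"
    using assms(1) by (auto simp: signed_perms_def bij_betw_def)
  with assms(2-4) show ?thesis by (auto dest: inj_onD)
qed

lemma signed_perm_position:
  assumes "\<pi> \<in> signed_perms N" "1 \<le> v" "v \<le> int N"
  obtains i where "i \<in> {1..N}" "\<bar>\<pi> i\<bar> = v"
proof -
  have "(\<lambda>i. \<bar>\<pi> i\<bar>) ` {1..N} = {1..int N}"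
    using assms(1) by (auto simp: signed_perms_def bij_betw_def)
  moreover have "v \<in> {1..int N}" using assms by auto
  ultimately have "v \<in> (\<lambda>i. \<bar>\<pi> i\<bar>) ` {1..N}" by blast
  with that show ?thesis by blast
qed

lemma signed_perm_extensional: "\<pi> \<in> signed_perms N \<Longrightarrow> \<pi> \<in> extensional {1..N}"
  by (auto simp: signed_perms_def PiE_def)

lemma signed_permI:
  assumes ext: "\<pi> \<in> extensional {1..N}"
    and bounds: "\<And>i. i \<in> {1..N} \<Longrightarrow> 1 \<le> \<bar>\<pi> i\<bar> \<and> \<bar>\<pi> i\<bar> \<le> int N"
    and inj: "\<And>i j. i \<in> {1..N} \<Longrightarrow> j \<in> {1..N} \<Longrightarrow> \<bar>\<pi> i\<bar> = \<bar>\<pi> j\<bar> \<Longrightarrow> i = j"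
  shows "\<pi> \<in> signed_perms N"
proof -
  have inj': "inj_on (\<lambda>i. \<bar>\<pi> i\<bar>) {1..N}" by (rule inj_onI) (rule inj)
  have "(\<lambda>i. \<bar>\<pi> i\<bar>) ` {1..N} = {1..int N}"
    by (rule card_subset_eq) (use bounds card_image[OF inj'] in auto)
  with inj' have "bij_betw (\<lambda>i. \<bar>\<pi> i\<bar>) {1..N} {1..int N}" by (simp add: bij_betw_def)
  moreover have "\<pi> i \<in> {- int N..int N} - {0}" if "i \<in> {1..N}" for i
    using bounds[OF that] by (auto simp: abs_le_iff)
  ultimately show ?thesis using ext by (auto simp: signed_perms_def PiE_def)
qed

lemma finite_signed_perms: "finite (signed_perms N)"
proof (rule finite_subset)
  show "signed_perms N \<subseteq> {1..N} \<rightarrow>\<^sub>E ({- int N..int N} - {0})"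
    by (auto simp: signed_perms_def)
qed (auto intro: finite_PiE)

lemma finite_Des_F: "finite (Des_F N \<pi>)"
  by (simp add: Des_F_def)

section \<open>Exchanging two consecutive absolute values\<close>

text \<open>
  Exchanges \<open>\<plusminus>a\<close> with \<open>\<plusminus>(a + 1)\<close> and leaves the sign of the letter alone, so that every position
  of a word keeps its sign.
\<close>

definition swap_abs :: "int \<Rightarrow> int \<Rightarrow> int" where
  "swap_abs a v = (if \<bar>v\<bar> = a then v + sgn v else if \<bar>v\<bar> = a + 1 then v - sgn v else v)"

definition swap_letters :: "nat \<Rightarrow> int \<Rightarrow> (nat \<Rightarrow> int) \<Rightarrow> nat \<Rightarrow> int" where
  "swap_letters N a \<pi> = (\<lambda>i\<in>{1..N}. swap_abs a (\<pi> i))"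

text \<open>
  The only configuration in which exchanging \<open>a\<close> and \<open>a + 1\<close> changes the flag descents: the two
  letters are then neighbours of equal sign, and the exchange reverses their comparison.
\<close>

definition linked :: "nat \<Rightarrow> int \<Rightarrow> (nat \<Rightarrow> int) \<Rightarrow> bool" where
  "linked N a \<pi> \<longleftrightarrow> (\<exists>i\<in>{1..<N}. sgn (\<pi> i) = sgn (\<pi> (Suc i)) \<and>
     {\<bar>\<pi> i\<bar>, \<bar>\<pi> (Suc i)\<bar>} = {a, a + 1})"

lemma sgn_swap_abs: "1 \<le> a \<Longrightarrow> sgn (swap_abs a v) = sgn v"
  by (auto simp: swap_abs_def sgn_if)

lemma abs_swap_abs:
  "1 \<le> a \<Longrightarrow> \<bar>swap_abs a v\<bar> = (if \<bar>v\<bar> = a then a + 1 else if \<bar>v\<bar> = a + 1 then a else \<bar>v\<bar>)"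
  by (auto simp: swap_abs_def sgn_if)

lemma swap_abs_swap_abs: "1 \<le> a \<Longrightarrow> swap_abs a (swap_abs a v) = v"
  by (auto simp: swap_abs_def sgn_if split: if_splits)

lemma swap_abs_neg_iff: "1 \<le> a \<Longrightarrow> swap_abs a v < 0 \<longleftrightarrow> v < 0"
  by (auto simp: swap_abs_def sgn_if)

lemma swap_letters_apply: "i \<in> {1..N} \<Longrightarrow> swap_letters N a \<pi> i = swap_abs a (\<pi> i)"
  by (simp add: swap_letters_def)

text \<open>
  No absolute value lies strictly between \<open>a\<close> and \<open>a + 1\<close>, so only a comparison of these two with
  each other can be reversed. If the signs differ, the flag order looks at the signs alone.
\<close>

lemma flag_less_swap_abs:
  assumes "1 \<le> a" "\<not> (sgn v = sgn w \<and> {\<bar>v\<bar>, \<bar>w\<bar>} = {a, a + 1})"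
  shows "flag_less (swap_abs a v) (swap_abs a w) \<longleftrightarrow> flag_less v w"
proof -
  have "0 < swap_abs a w \<longleftrightarrow> 0 < w"
    using assms(1) by (auto simp: swap_abs_def sgn_if)
  moreover have "\<bar>swap_abs a v\<bar> < \<bar>swap_abs a w\<bar> \<longleftrightarrow> \<bar>v\<bar> < \<bar>w\<bar>" if "sgn v = sgn w"
    using assms that by (auto simp: abs_swap_abs doubleton_eq_iff)
  ultimately show ?thesis
    using assms(1) by (auto simp: flag_less_def sgn_swap_abs swap_abs_neg_iff)
qed

lemma swap_letters_swap_letters:
  assumes "\<pi> \<in> extensional {1..N}" "1 \<le> a"
  shows "swap_letters N a (swap_letters N a \<pi>) = \<pi>"
  by (rule extensionalityI[of _ "{1..N}"])
    (use assms in \<open>auto simp: swap_letters_def swap_abs_swap_abs\<close>)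

lemma swap_letters_signed_perm:
  assumes "\<pi> \<in> signed_perms N" "1 \<le> a" "a + 1 \<le> int N"
  shows "swap_letters N a \<pi> \<in> signed_perms N"
proof (rule signed_permI)
  show "swap_letters N a \<pi> \<in> extensional {1..N}" by (simp add: swap_letters_def)
next
  fix i assume "i \<in> {1..N}"
  with signed_perm_abs_bounds[OF assms(1) this]
  show "1 \<le> \<bar>swap_letters N a \<pi> i\<bar> \<and> \<bar>swap_letters N a \<pi> i\<bar> \<le> int N"
    using assms(2,3) by (auto simp: swap_letters_apply abs_swap_abs)
next
  fix i j assume "i \<in> {1..N}" "j \<in> {1..N}" "\<bar>swap_letters N a \<pi> i\<bar> = \<bar>swap_letters N a \<pi> j\<bar>"
  then show "i = j" using assms(2)
    by (intro signed_perm_abs_inject[OF assms(1)])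
      (auto simp: swap_letters_apply abs_swap_abs split: if_splits)
qed

lemma swap_letters_restricted:
  assumes "\<pi> \<in> restricted_signed_perms N S" "1 \<le> a" "a + 1 \<le> int N"
  shows "swap_letters N a \<pi> \<in> restricted_signed_perms N S"
  using assms
  by (auto simp: restricted_signed_perms_def swap_letters_signed_perm swap_letters_apply
      sign_of_def swap_abs_neg_iff)

lemma Neg_swap_letters: "1 \<le> a \<Longrightarrow> Neg N (swap_letters N a \<pi>) = Neg N \<pi>"
  by (auto simp: Neg_def swap_letters_apply swap_abs_neg_iff)

lemma Des_F_swap_letters:
  assumes "1 \<le> a" "\<not> linked N a \<pi>"
  shows "Des_F N (swap_letters N a \<pi>) = Des_F N \<pi>"
proof -
  have "flag_less (swap_letters N a \<pi> (i + 1)) (swap_letters N a \<pi> i) \<longleftrightarrow>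
      flag_less (\<pi> (i + 1)) (\<pi> i)" if i: "i \<in> {1..N - 1}" for i
  proof -
    have "\<not> (sgn (\<pi> (i + 1)) = sgn (\<pi> i) \<and> {\<bar>\<pi> (i + 1)\<bar>, \<bar>\<pi> i\<bar>} = {a, a + 1})"
      using assms(2) i by (auto simp: linked_def insert_commute)
    moreover have "i \<in> {1..N}" "i + 1 \<in> {1..N}" using i by auto
    ultimately show ?thesis
      using flag_less_swap_abs[OF assms(1)] swap_letters_apply by presburger
  qed
  then show ?thesis by (auto simp: Des_F_def)
qed

lemma linked_swap_letters:
  assumes "linked N b \<pi>" "1 \<le> a" "b + 1 < a"
  shows "linked N b (swap_letters N a \<pi>)"
proof -
  obtain i where i: "i \<in> {1..<N}" "sgn (\<pi> i) = sgn (\<pi> (Suc i))"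
    "{\<bar>\<pi> i\<bar>, \<bar>\<pi> (Suc i)\<bar>} = {b, b + 1}"
    using assms(1) by (auto simp: linked_def)
  then have "\<bar>\<pi> i\<bar> < a" "\<bar>\<pi> (Suc i)\<bar> < a"
    using assms(3) by (auto simp: doubleton_eq_iff)
  with i show ?thesis
    using assms(2) unfolding linked_def
    by (intro bexI[of _ i]) (auto simp: swap_letters_apply sgn_swap_abs abs_swap_abs)
qed

lemma linked_swap_letters_same:
  assumes "linked N a \<pi>" "1 \<le> a"
  shows "linked N a (swap_letters N a \<pi>)"
proof -
  obtain i where i: "i \<in> {1..<N}" "sgn (\<pi> i) = sgn (\<pi> (Suc i))"
    "{\<bar>\<pi> i\<bar>, \<bar>\<pi> (Suc i)\<bar>} = {a, a + 1}"
    using assms(1) by (auto simp: linked_def)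
  then show ?thesis
    using assms(2) unfolding linked_def
    by (intro bexI[of _ i])
      (auto simp: swap_letters_apply sgn_swap_abs abs_swap_abs doubleton_eq_iff)
qed

text \<open>
  The pair of positions of the two exchanged values is the one new inversion. All other pairs
  compare as before, because no third letter has a value from \<open>a\<close> to \<open>a + 1\<close>.
\<close>

lemma inversions_exchange:
  fixes f g :: "nat \<Rightarrow> int"
  assumes inj: "inj_on f {1..N}" and p: "p \<in> {1..N}" and r: "r \<in> {1..N}" and "p < r"
    and "f p = a" "f r = a + 1" "g p = a + 1" "g r = a"
    and rest: "\<And>i. i \<in> {1..N} \<Longrightarrow> i \<noteq> p \<Longrightarrow> i \<noteq> r \<Longrightarrow> g i = f i"
  shows "inversions N g = Suc (inversions N f)"
proof -
  define I where "I h = {(i, j). i \<in> {1..N} \<and> j \<in> {1..N} \<and> i < j \<and> h i > h j}"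
    for h :: "nat \<Rightarrow> int"
  have away: "f i \<noteq> a \<and> f i \<noteq> a + 1" if "i \<in> {1..N}" "i \<noteq> p" "i \<noteq> r" for i
    using that inj_onD[OF inj, of i p] inj_onD[OF inj, of i r] p r assms(5,6) by auto
  have eq: "g i > g j \<longleftrightarrow> (i = p \<and> j = r) \<or> f i > f j"
    if "i \<in> {1..N}" "j \<in> {1..N}" "i < j" for i j
  proof (cases "i = p \<or> i = r"; cases "j = p \<or> j = r")
    assume "i = p \<or> i = r" "j = p \<or> j = r"
    then show ?thesis using \<open>i < j\<close> assms(4-8) by auto
  next
    assume "i = p \<or> i = r" "\<not> (j = p \<or> j = r)"
    then show ?thesis using away[of j] rest[of j] that assms(4-8) by auto
  next
    assume "\<not> (i = p \<or> i = r)" "j = p \<or> j = r"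
    then show ?thesis using away[of i] rest[of i] that assms(4-8) by auto
  next
    assume "\<not> (i = p \<or> i = r)" "\<not> (j = p \<or> j = r)"
    then show ?thesis using rest[of i] rest[of j] that by auto
  qed
  have "I g = insert (p, r) (I f)"
    using eq p r assms(4) unfolding I_def by blast
  moreover have "(p, r) \<notin> I f" using assms(5,6) by (auto simp: I_def)
  moreover have "finite (I f)"
    by (rule finite_subset[of _ "{1..N} \<times> {1..N}"]) (auto simp: I_def)
  ultimately show ?thesis by (simp add: inversions_def I_def)
qed

text \<open>
  Singles out one element of each pair \<open>{\<pi>, swap_letters N a \<pi>}\<close>.
\<close>

definition in_order :: "nat \<Rightarrow> int \<Rightarrow> (nat \<Rightarrow> int) \<Rightarrow> bool" where
  "in_order N a \<pi> \<longleftrightarrow> (\<exists>p\<in>{1..N}. \<exists>r\<in>{1..N}. p < r \<and> \<bar>\<pi> p\<bar> = a \<and> \<bar>\<pi> r\<bar> = a + 1)"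

lemma swap_letters_effect:
  assumes "\<pi> \<in> signed_perms N" "1 \<le> a" "a + 1 \<le> int N"
  shows in_order_swap_letters: "in_order N a (swap_letters N a \<pi>) \<longleftrightarrow> \<not> in_order N a \<pi>"
    and sign_swap_letters: "(-1) ^ inversions N (\<lambda>i. \<bar>swap_letters N a \<pi> i\<bar>) =
      - ((-1) ^ inversions N (\<lambda>i. \<bar>\<pi> i\<bar>) :: 'a::comm_ring_1)"
proof -
  define \<sigma> where "\<sigma> = swap_letters N a \<pi>"
  obtain p where p: "p \<in> {1..N}" "\<bar>\<pi> p\<bar> = a"
    using signed_perm_position[OF assms(1), of a] assms(2,3) by auto
  obtain r where r: "r \<in> {1..N}" "\<bar>\<pi> r\<bar> = a + 1"
    using signed_perm_position[OF assms(1), of "a + 1"] assms(2,3) by auto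
  have "p \<noteq> r" using p r by auto
  have \<pi>_eq: "i \<in> {1..N} \<Longrightarrow> \<bar>\<pi> i\<bar> = a \<longleftrightarrow> i = p" "i \<in> {1..N} \<Longrightarrow> \<bar>\<pi> i\<bar> = a + 1 \<longleftrightarrow> i = r" for i
    using signed_perm_abs_inject[OF assms(1)] p r by auto
  have \<sigma>: "\<bar>\<sigma> i\<bar> = (if i = p then a + 1 else if i = r then a else \<bar>\<pi> i\<bar>)" if "i \<in> {1..N}" for i
    using that assms(2) \<pi>_eq[OF that] by (auto simp: \<sigma>_def swap_letters_apply abs_swap_abs)
  have \<sigma>_eq: "\<bar>\<sigma> i\<bar> = a \<longleftrightarrow> i = r" "\<bar>\<sigma> i\<bar> = a + 1 \<longleftrightarrow> i = p" if "i \<in> {1..N}" for i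
    using \<sigma>[OF that] \<pi>_eq[OF that] \<open>p \<noteq> r\<close> by auto
  have "in_order N a \<pi> \<longleftrightarrow> p < r"
    unfolding in_order_def using \<pi>_eq p(1) r(1) by blast
  moreover have "in_order N a \<sigma> \<longleftrightarrow> r < p"
    unfolding in_order_def using \<sigma>_eq p(1) r(1) by blast
  ultimately show "in_order N a (swap_letters N a \<pi>) \<longleftrightarrow> \<not> in_order N a \<pi>"
    using \<open>p \<noteq> r\<close> by (auto simp: \<sigma>_def)
  have inj_\<pi>: "inj_on (\<lambda>i. \<bar>\<pi> i\<bar>) {1..N}"
    using assms(1) by (auto simp: signed_perms_def bij_betw_def)
  have inj_\<sigma>: "inj_on (\<lambda>i. \<bar>\<sigma> i\<bar>) {1..N}"
    using swap_letters_signed_perm[OF assms] by (auto simp: \<sigma>_def signed_perms_def bij_betw_def)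
  have "inversions N (\<lambda>i. \<bar>\<sigma> i\<bar>) = Suc (inversions N (\<lambda>i. \<bar>\<pi> i\<bar>)) \<or>
      inversions N (\<lambda>i. \<bar>\<pi> i\<bar>) = Suc (inversions N (\<lambda>i. \<bar>\<sigma> i\<bar>))"
  proof (cases "p < r")
    case True
    then have "inversions N (\<lambda>i. \<bar>\<sigma> i\<bar>) = Suc (inversions N (\<lambda>i. \<bar>\<pi> i\<bar>))"
      using p r \<sigma> \<open>p \<noteq> r\<close>
      by (intro inversions_exchange[OF inj_\<pi> p(1) r(1), where a = a]) auto
    then show ?thesis ..
  next
    case False
    then have "inversions N (\<lambda>i. \<bar>\<pi> i\<bar>) = Suc (inversions N (\<lambda>i. \<bar>\<sigma> i\<bar>))"
      using p r \<sigma> \<open>p \<noteq> r\<close>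
      by (intro inversions_exchange[OF inj_\<sigma> r(1) p(1), where a = a]) auto
    then show ?thesis ..
  qed
  then show "(-1) ^ inversions N (\<lambda>i. \<bar>swap_letters N a \<pi> i\<bar>) =
      - ((-1) ^ inversions N (\<lambda>i. \<bar>\<pi> i\<bar>) :: 'a)"
    unfolding \<sigma>_def by (elim disjE) simp_all
qed

section \<open>Cancellation\<close>

text \<open>
  The predicate \<open>P\<close> selects one element of every two-element orbit, so that the terms cancel orbit
  by orbit. Deducing \<open>2 * sum f A = 0\<close> from the reversal of signs alone would not be enough in a
  group with elements of order two.
\<close>

lemma sum_sign_reversing_involution:
  fixes f :: "'b \<Rightarrow> 'a::ab_group_add"
  assumes "finite A"
    and closed: "\<And>x. x \<in> A \<Longrightarrow> \<phi> x \<in> A"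
    and invol: "\<And>x. x \<in> A \<Longrightarrow> \<phi> (\<phi> x) = x"
    and side: "\<And>x. x \<in> A \<Longrightarrow> P (\<phi> x) \<longleftrightarrow> \<not> P x"
    and reverse: "\<And>x. x \<in> A \<Longrightarrow> f (\<phi> x) = - f x"
  shows "sum f A = 0"
proof -
  have "(\<Sum>x | x \<in> A \<and> \<not> P x. f x) = (\<Sum>x | x \<in> A \<and> P x. - f x)"
    by (rule sum.reindex_bij_witness[of _ \<phi> \<phi>]) (use assms in auto)
  moreover have "sum f A = (\<Sum>x | x \<in> A \<and> P x. f x) + (\<Sum>x | x \<in> A \<and> \<not> P x. f x)"
    by (subst sum.union_disjoint[symmetric]) (auto intro!: sum.cong \<open>finite A\<close>)
  ultimately show ?thesis by (simp add: sum_negf)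
qed

text \<open>
  Where \<open>a\<close> and \<open>a + 1\<close> are not linked, exchanging them preserves \<^const>\<open>Neg\<close> and \<^const>\<open>Des_F\<close>,
  hence any weight \<open>w\<close> built from these two sets, and reverses the sign.
\<close>

lemma sum_eq_sum_linked:
  fixes w :: "nat set \<Rightarrow> nat set \<Rightarrow> 'a::comm_ring_1"
  assumes X: "X \<subseteq> signed_perms N" and a: "1 \<le> a" "a + 1 \<le> int N"
    and closed: "\<And>\<pi>. \<pi> \<in> X \<Longrightarrow> swap_letters N a \<pi> \<in> X"
  shows "(\<Sum>\<pi>\<in>X. (-1) ^ inversions N (\<lambda>i. \<bar>\<pi> i\<bar>) * w (Neg N \<pi>) (Des_F N \<pi>)) =
    (\<Sum>\<pi> | \<pi> \<in> X \<and> linked N a \<pi>.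
      (-1) ^ inversions N (\<lambda>i. \<bar>\<pi> i\<bar>) * w (Neg N \<pi>) (Des_F N \<pi>))"
    (is "sum ?f X = sum ?f ?Y")
proof -
  have "finite X" by (rule finite_subset[OF X finite_signed_perms])
  have "sum ?f (X - ?Y) = 0"
  proof (rule sum_sign_reversing_involution[where \<phi> = "swap_letters N a" and P = "in_order N a"])
    fix \<pi> assume \<pi>: "\<pi> \<in> X - ?Y"
    then have \<pi>': "\<pi> \<in> signed_perms N" "\<not> linked N a \<pi>" using X by auto
    show invol: "swap_letters N a (swap_letters N a \<pi>) = \<pi>"
      by (rule swap_letters_swap_letters[OF signed_perm_extensional[OF \<pi>'(1)] a(1)])
    show "swap_letters N a \<pi> \<in> X - ?Y"
      using \<pi> closed linked_swap_letters_same[of N a "swap_letters N a \<pi>"] a invol by auto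
    show "in_order N a (swap_letters N a \<pi>) \<longleftrightarrow> \<not> in_order N a \<pi>"
      using in_order_swap_letters \<pi>' a by blast
    show "?f (swap_letters N a \<pi>) = - ?f \<pi>"
      using \<pi>' a by (simp add: sign_swap_letters Neg_swap_letters Des_F_swap_letters)
  qed (use \<open>finite X\<close> in auto)
  then show ?thesis
    using sum.subset_diff[of ?Y X ?f] \<open>finite X\<close> by auto
qed

text \<open>
  The cancellation is carried out for the pairs \<open>{1, 2}, {3, 4}, \<dots>\<close> one after the other. It can be
  repeated because exchanging \<open>2 * m + 1\<close> and \<open>2 * m + 2\<close> does not disturb the links between smaller
  values, so the words that survived so far are closed under the next exchange.
\<close>

lemma sum_eq_sum_all_linked:
  fixes w :: "nat set \<Rightarrow> nat set \<Rightarrow> 'a::comm_ring_1"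
  assumes "m \<le> n"
  shows "(\<Sum>\<pi>\<in>restricted_signed_perms (2 * n) H.
      (-1) ^ inversions (2 * n) (\<lambda>i. \<bar>\<pi> i\<bar>) * w (Neg (2 * n) \<pi>) (Des_F (2 * n) \<pi>)) =
    (\<Sum>\<pi> | \<pi> \<in> restricted_signed_perms (2 * n) H \<and> (\<forall>k\<in>{1..m}. linked (2 * n) (2 * int k - 1) \<pi>).
      (-1) ^ inversions (2 * n) (\<lambda>i. \<bar>\<pi> i\<bar>) * w (Neg (2 * n) \<pi>) (Des_F (2 * n) \<pi>))"
    (is "?lhs = sum ?f (?X m)")
  using assms
proof (induction m)
  case 0
  show ?case by simp
next
  case (Suc m)
  then have "?lhs = sum ?f (?X m)" by simp
  also have "\<dots> = sum ?f {\<pi> \<in> ?X m. linked (2 * n) (2 * int (Suc m) - 1) \<pi>}"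
  proof (rule sum_eq_sum_linked)
    show "?X m \<subseteq> signed_perms (2 * n)" by (auto simp: restricted_signed_perms_def)
    show "swap_letters (2 * n) (2 * int (Suc m) - 1) \<pi> \<in> ?X m" if "\<pi> \<in> ?X m" for \<pi>
      using that Suc.prems by (auto intro!: swap_letters_restricted linked_swap_letters)
  qed (use Suc.prems in auto)
  also have "{\<pi> \<in> ?X m. linked (2 * n) (2 * int (Suc m) - 1) \<pi>} = ?X (Suc m)"
    by (auto simp: atLeastAtMostSuc_conv)
  finally show ?case .
qed

section \<open>Parity of the length\<close>

lemma sign_inversions_eq_prod:
  "((-1) ^ inversions N f :: 'a::comm_ring_1) =
    (\<Prod>(i, j)\<in>{(i, j). i \<in> {1..N} \<and> j \<in> {1..N} \<and> i < j}. if f j < f i then -1 else 1)"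
proof -
  define D where "D = {(i, j). i \<in> {1..N} \<and> j \<in> {1..N} \<and> i < j}"
  have fin: "finite D"
    by (rule finite_subset[of _ "{1..N} \<times> {1..N}"]) (auto simp: D_def)
  have "(\<Prod>(i, j)\<in>D. if f j < f i then -1 else 1 :: 'a) = (\<Prod>x | x \<in> D \<and> f (snd x) < f (fst x). -1)"
    unfolding prod.inter_filter[OF fin] by (simp add: case_prod_unfold)
  also have "\<dots> = (-1) ^ card {x \<in> D. f (snd x) < f (fst x)}" by simp
  also have "{x \<in> D. f (snd x) < f (fst x)} =
      {(i, j). i \<in> {1..N} \<and> j \<in> {1..N} \<and> i < j \<and> f i > f j}"
    by (auto simp: D_def)
  finally show ?thesis by (simp add: inversions_def D_def)
qed

lemma card_smaller_abs:
  assumes "\<pi> \<in> signed_perms N" "i \<in> {1..N}"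
  shows "card {j \<in> {1..N}. \<bar>\<pi> j\<bar> < \<bar>\<pi> i\<bar>} = nat \<bar>\<pi> i\<bar> - 1"
proof -
  have "inj_on (\<lambda>j. \<bar>\<pi> j\<bar>) {j \<in> {1..N}. \<bar>\<pi> j\<bar> < \<bar>\<pi> i\<bar>}"
    using signed_perm_abs_inject[OF assms(1)] by (auto intro!: inj_onI)
  then have "card {j \<in> {1..N}. \<bar>\<pi> j\<bar> < \<bar>\<pi> i\<bar>} =
      card ((\<lambda>j. \<bar>\<pi> j\<bar>) ` {j \<in> {1..N}. \<bar>\<pi> j\<bar> < \<bar>\<pi> i\<bar>})"
    by (simp add: card_image)
  also have "(\<lambda>j. \<bar>\<pi> j\<bar>) ` {j \<in> {1..N}. \<bar>\<pi> j\<bar> < \<bar>\<pi> i\<bar>} = {1..<\<bar>\<pi> i\<bar>}"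
    (is "?lhs = ?rhs")
  proof
    show "?lhs \<subseteq> ?rhs" using signed_perm_abs_bounds[OF assms(1)] by auto
    show "?rhs \<subseteq> ?lhs"
    proof
      fix v assume v: "v \<in> ?rhs"
      then obtain j where "j \<in> {1..N}" "\<bar>\<pi> j\<bar> = v"
        using signed_perm_position[OF assms(1), of v] signed_perm_abs_bounds[OF assms] by auto
      with v show "v \<in> ?lhs" by auto
    qed
  qed
  finally show ?thesis by simp
qed

text \<open>
  Let every negative letter contribute a factor \<open>-1\<close> for each letter of smaller absolute value. In a
  pair of letters this gives \<open>-1\<close> exactly when passing to absolute values reverses their comparison:
  if both are negative, the one of larger absolute value contributes; if only one is negative, it
  contributes if and only if its absolute value is the larger one. Since the absolute values are
  \<open>1, \<dots>, N\<close>, a negative letter \<open>\<pi> i\<close> contributes \<open>\<bar>\<pi> i\<bar> - 1\<close> factors in total.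
\<close>

lemma sign_inversions_abs:
  assumes \<pi>: "\<pi> \<in> signed_perms N"
  shows "((-1) ^ inversions N \<pi> :: 'a::comm_ring_1) =
    (-1) ^ inversions N (\<lambda>i. \<bar>\<pi> i\<bar>) * (\<Prod>i\<in>Neg N \<pi>. (-1) ^ (nat \<bar>\<pi> i\<bar> - 1))"
proof -
  define D where "D = {(i, j). i \<in> {1..N} \<and> j \<in> {1..N} \<and> i < j}"
  define u where "u i j = (if \<pi> i < 0 \<and> \<bar>\<pi> j\<bar> < \<bar>\<pi> i\<bar> then -1 else 1 :: 'a)" for i j
  have fin: "finite D"
    by (rule finite_subset[of _ "{1..N} \<times> {1..N}"]) (auto simp: D_def)
  have pair: "(if \<pi> j < \<pi> i then -1 else 1 :: 'a) =
      (if \<bar>\<pi> j\<bar> < \<bar>\<pi> i\<bar> then -1 else 1) * (u i j * u j i)" if "(i, j) \<in> D" for i j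
  proof -
    have "\<bar>\<pi> i\<bar> \<noteq> \<bar>\<pi> j\<bar>"
      using that signed_perm_abs_inject[OF \<pi>] by (auto simp: D_def)
    then show ?thesis unfolding u_def by (cases "\<pi> i < 0"; cases "\<pi> j < 0") auto
  qed
  have "(-1) ^ inversions N \<pi> = (\<Prod>(i, j)\<in>D. if \<pi> j < \<pi> i then -1 else 1 :: 'a)"
    by (simp add: sign_inversions_eq_prod D_def)
  also have "\<dots> = (\<Prod>(i, j)\<in>D. (if \<bar>\<pi> j\<bar> < \<bar>\<pi> i\<bar> then -1 else 1) * (u i j * u j i))"
    using pair by (intro prod.cong) auto
  also have "\<dots> = (\<Prod>(i, j)\<in>D. if \<bar>\<pi> j\<bar> < \<bar>\<pi> i\<bar> then -1 else 1) *
      ((\<Prod>(i, j)\<in>D. u i j) * (\<Prod>(i, j)\<in>D. u j i))"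
    by (simp add: prod.distrib case_prod_unfold)
  also have "(\<Prod>(i, j)\<in>D. if \<bar>\<pi> j\<bar> < \<bar>\<pi> i\<bar> then -1 else 1 :: 'a) = (-1) ^ inversions N (\<lambda>i. \<bar>\<pi> i\<bar>)"
    by (simp add: sign_inversions_eq_prod D_def)
  \<comment> \<open>The two products run over the pairs above and below the diagonal, and \<open>u i i = 1\<close>.\<close>
  also have "(\<Prod>(i, j)\<in>D. u i j) * (\<Prod>(i, j)\<in>D. u j i) = (\<Prod>i\<in>{1..N}. \<Prod>j\<in>{1..N}. u i j)"
  proof -
    have "(\<Prod>(i, j)\<in>D. u j i) = (\<Prod>(i, j)\<in>prod.swap ` D. u i j)"
      by (subst prod.reindex) (auto simp: case_prod_unfold)
    then have "(\<Prod>(i, j)\<in>D. u i j) * (\<Prod>(i, j)\<in>D. u j i) = (\<Prod>(i, j)\<in>D \<union> prod.swap ` D. u i j)"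
      using fin by (subst prod.union_disjoint) (auto simp: D_def)
    also have "\<dots> = (\<Prod>(i, j)\<in>{1..N} \<times> {1..N}. u i j)"
    proof (rule prod.mono_neutral_left)
      show "\<forall>x\<in>{1..N} \<times> {1..N} - (D \<union> prod.swap ` D). (case x of (i, j) \<Rightarrow> u i j) = 1"
      proof
        fix x assume x: "x \<in> {1..N} \<times> {1..N} - (D \<union> prod.swap ` D)"
        have "prod.swap x \<in> D \<Longrightarrow> x \<in> prod.swap ` D"
          by (metis image_eqI swap_swap)
        with x have "fst x = snd x" by (cases x) (auto simp: D_def)
        then show "(case x of (i, j) \<Rightarrow> u i j) = 1" by (simp add: u_def case_prod_unfold)
      qed
    qed (auto simp: D_def)
    finally show ?thesis by (simp add: prod.cartesian_product)
  qed
  also have "\<dots> = (\<Prod>i\<in>{1..N}. if \<pi> i < 0 then (-1) ^ (nat \<bar>\<pi> i\<bar> - 1) else 1)"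
  proof (intro prod.cong refl)
    fix i assume i: "i \<in> {1..N}"
    show "(\<Prod>j\<in>{1..N}. u i j) = (if \<pi> i < 0 then (-1) ^ (nat \<bar>\<pi> i\<bar> - 1) else 1)"
    proof (cases "\<pi> i < 0")
      case True
      then have "(\<Prod>j\<in>{1..N}. u i j) = (\<Prod>j | j \<in> {1..N} \<and> \<bar>\<pi> j\<bar> < \<bar>\<pi> i\<bar>. -1)"
        by (subst prod.inter_filter) (auto simp: u_def)
      also have "\<dots> = (-1) ^ (nat \<bar>\<pi> i\<bar> - 1)"
        using card_smaller_abs[OF \<pi> i] by simp
      finally show ?thesis using True by simp
    qed (simp add: u_def)
  qed
  also have "\<dots> = (\<Prod>i\<in>Neg N \<pi>. (-1) ^ (nat \<bar>\<pi> i\<bar> - 1))"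
    unfolding Neg_def by (rule prod.inter_filter[symmetric]) simp
  finally show ?thesis .
qed

text \<open>
  Each negative letter contributes \<open>\<bar>\<pi> i\<bar> - 1\<close> through the inversions and \<open>\<bar>\<pi> i\<bar>\<close> through the
  subtracted sum. Together this is odd.
\<close>

lemma sign_length_B:
  assumes \<pi>: "\<pi> \<in> signed_perms N"
  shows "((-1) ^ length_B N \<pi> :: 'a::comm_ring_1) =
    (-1) ^ inversions N (\<lambda>i. \<bar>\<pi> i\<bar>) * (-1) ^ neg N \<pi>"
proof -
  have "- (\<Sum>i\<in>Neg N \<pi>. \<pi> i) = (\<Sum>i\<in>Neg N \<pi>. int (nat \<bar>\<pi> i\<bar>))"
    by (simp add: sum_negf[symmetric]) (auto simp: Neg_def intro!: sum.cong)
  then have "int (inversions N \<pi>) - (\<Sum>i\<in>Neg N \<pi>. \<pi> i) =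
      int (inversions N \<pi> + (\<Sum>i\<in>Neg N \<pi>. nat \<bar>\<pi> i\<bar>))"
    unfolding of_nat_add of_nat_sum by linarith
  then have "length_B N \<pi> = inversions N \<pi> + (\<Sum>i\<in>Neg N \<pi>. nat \<bar>\<pi> i\<bar>)"
    unfolding length_B_def by (simp only: nat_int)
  then have "((-1) ^ length_B N \<pi> :: 'a) = (-1) ^ inversions N (\<lambda>i. \<bar>\<pi> i\<bar>) *
      (\<Prod>i\<in>Neg N \<pi>. (-1) ^ (nat \<bar>\<pi> i\<bar> - 1) * (-1) ^ nat \<bar>\<pi> i\<bar>)"
    by (simp add: power_add power_sum sign_inversions_abs[OF \<pi>] prod.distrib mult.assoc)
  also have "(\<Prod>i\<in>Neg N \<pi>. (-1) ^ (nat \<bar>\<pi> i\<bar> - 1) * (-1) ^ nat \<bar>\<pi> i\<bar> :: 'a) = (\<Prod>i\<in>Neg N \<pi>. -1)"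
  proof (intro prod.cong refl)
    fix i assume "i \<in> Neg N \<pi>"
    then obtain k where "nat \<bar>\<pi> i\<bar> = Suc k"
      by (cases "nat \<bar>\<pi> i\<bar>") (auto simp: Neg_def)
    then show "(-1) ^ (nat \<bar>\<pi> i\<bar> - 1) * (-1) ^ nat \<bar>\<pi> i\<bar> = (-1 :: 'a)"
      by (simp flip: power_add mult_2)
  qed
  finally show ?thesis by (simp add: neg_def)
qed

section \<open>Inflation of a signed permutation\<close>

text \<open>
  Every letter \<open>\<tau> i\<close> becomes two letters of the same sign at the positions \<open>2 * i - 1\<close> and \<open>2 * i\<close>, with
  absolute values \<open>2 * \<bar>\<tau> i\<bar> - 1\<close> and \<open>2 * \<bar>\<tau> i\<bar>\<close>. They increase if \<open>i \<notin> F\<close> and decrease if \<open>i \<in> F\<close>.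
  The position \<open>p\<close> belongs to the block \<open>(p + 1) div 2\<close>.
\<close>

definition inflate :: "nat \<Rightarrow> (nat \<Rightarrow> int) \<Rightarrow> nat set \<Rightarrow> nat \<Rightarrow> int" where
  "inflate n \<tau> F = (\<lambda>p\<in>{1..2 * n}. let i = (p + 1) div 2 in
     sgn (\<tau> i) * (2 * \<bar>\<tau> i\<bar> - of_bool (odd p \<noteq> (i \<in> F))))"

text \<open>
  Together with \<open>flips\<close> the inverse of \<^const>\<open>inflate\<close> on words all of whose pairs are linked. The
  letters \<open>2 * k - 1\<close> and \<open>2 * k\<close> of a block both yield \<open>k\<close>, so it suffices to look at one of them.
\<close>

definition deflate :: "nat \<Rightarrow> (nat \<Rightarrow> int) \<Rightarrow> nat \<Rightarrow> int" where
  "deflate n \<pi> = (\<lambda>i\<in>{1..n}. sgn (\<pi> (2 * i)) * ((\<bar>\<pi> (2 * i)\<bar> + 1) div 2))"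

definition flips :: "nat \<Rightarrow> (nat \<Rightarrow> int) \<Rightarrow> nat set" where
  "flips n \<pi> = {i \<in> {1..n}. \<bar>\<pi> (2 * i)\<bar> < \<bar>\<pi> (2 * i - 1)\<bar>}"

lemma block_cases:
  assumes "p \<in> {1..2 * n}"
  obtains i :: nat where "i \<in> {1..n}" "p = 2 * i - 1" | i where "i \<in> {1..n}" "p = 2 * i"
proof (cases "odd p")
  case True
  then obtain j where "p = 2 * j + 1" by (elim oddE)
  with assms that(1)[of "j + 1"] show ?thesis by auto
next
  case False
  then obtain j where "p = 2 * j" by (auto elim: evenE)
  with assms that(2)[of j] show ?thesis by auto
qed

lemma inflate_at:
  assumes "i \<in> {1..n}"
  shows inflate_odd: "inflate n \<tau> F (2 * i - 1) = sgn (\<tau> i) * (2 * \<bar>\<tau> i\<bar> - of_bool (i \<notin> F))"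
    and inflate_even: "inflate n \<tau> F (2 * i) = sgn (\<tau> i) * (2 * \<bar>\<tau> i\<bar> - of_bool (i \<in> F))"
proof -
  have "2 * i - 1 \<in> {1..2 * n}" "(2 * i - 1 + 1) div 2 = i" "odd (2 * i - 1)"
    using assms by auto
  then show "inflate n \<tau> F (2 * i - 1) = sgn (\<tau> i) * (2 * \<bar>\<tau> i\<bar> - of_bool (i \<notin> F))"
    by (simp add: inflate_def Let_def)
  show "inflate n \<tau> F (2 * i) = sgn (\<tau> i) * (2 * \<bar>\<tau> i\<bar> - of_bool (i \<in> F))"
    using assms by (simp add: inflate_def Let_def)
qed

lemma inflate_letter:
  assumes \<tau>: "\<tau> \<in> signed_perms n" and p: "p \<in> {1..2 * n}"
  shows sgn_inflate: "sgn (inflate n \<tau> F p) = sgn (\<tau> ((p + 1) div 2))"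
    and abs_inflate: "\<bar>inflate n \<tau> F p\<bar> =
      2 * \<bar>\<tau> ((p + 1) div 2)\<bar> - of_bool (odd p \<noteq> ((p + 1) div 2 \<in> F))"
proof -
  define i where "i = (p + 1) div 2"
  have "i \<in> {1..n}" using p by (auto simp: i_def)
  from signed_perm_abs_bounds[OF \<tau> this]
  have pos: "2 * \<bar>\<tau> i\<bar> - of_bool (odd p \<noteq> (i \<in> F)) > 0" and nz: "\<bar>sgn (\<tau> i)\<bar> = 1"
    by (auto simp: sgn_if)
  have eq: "inflate n \<tau> F p = sgn (\<tau> i) * (2 * \<bar>\<tau> i\<bar> - of_bool (odd p \<noteq> (i \<in> F)))"
    using p by (simp add: inflate_def Let_def i_def)
  show "sgn (inflate n \<tau> F p) = sgn (\<tau> ((p + 1) div 2))"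
    unfolding eq sgn_mult i_def[symmetric] using pos by simp
  show "\<bar>inflate n \<tau> F p\<bar> = 2 * \<bar>\<tau> ((p + 1) div 2)\<bar> - of_bool (odd p \<noteq> ((p + 1) div 2 \<in> F))"
    unfolding eq abs_mult i_def[symmetric] nz using pos by simp
qed

lemma inflate_signed_perm:
  assumes \<tau>: "\<tau> \<in> signed_perms n"
  shows "inflate n \<tau> F \<in> signed_perms (2 * n)"
proof (rule signed_permI)
  show "inflate n \<tau> F \<in> extensional {1..2 * n}" by (simp add: inflate_def)
next
  fix p assume p: "p \<in> {1..2 * n}"
  then have i: "(p + 1) div 2 \<in> {1..n}" by auto
  have "0 \<le> (of_bool (odd p \<noteq> ((p + 1) div 2 \<in> F)) :: int)"
    "(of_bool (odd p \<noteq> ((p + 1) div 2 \<in> F)) :: int) \<le> 1" by simp_all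
  with signed_perm_abs_bounds[OF \<tau> i]
  show "1 \<le> \<bar>inflate n \<tau> F p\<bar> \<and> \<bar>inflate n \<tau> F p\<bar> \<le> int (2 * n)"
    unfolding abs_inflate[OF \<tau> p] by linarith
next
  fix p r assume p: "p \<in> {1..2 * n}" and r: "r \<in> {1..2 * n}"
    and eq: "\<bar>inflate n \<tau> F p\<bar> = \<bar>inflate n \<tau> F r\<bar>"
  define i j where "i = (p + 1) div 2" and "j = (r + 1) div 2"
  have ij: "i \<in> {1..n}" "j \<in> {1..n}" using p r by (auto simp: i_def j_def)
  have *: "2 * \<bar>\<tau> i\<bar> - of_bool (odd p \<noteq> (i \<in> F)) = 2 * \<bar>\<tau> j\<bar> - (of_bool (odd r \<noteq> (j \<in> F)) :: int)"
    using eq unfolding abs_inflate[OF \<tau> p] abs_inflate[OF \<tau> r] i_def j_def .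
  have "\<bar>\<tau> i\<bar> = \<bar>\<tau> j\<bar> \<and> (odd p \<noteq> (i \<in> F)) = (odd r \<noteq> (j \<in> F))"
    if "2 * \<bar>\<tau> i\<bar> - of_bool P = 2 * \<bar>\<tau> j\<bar> - (of_bool Q :: int)"
      "P = (odd p \<noteq> (i \<in> F))" "Q = (odd r \<noteq> (j \<in> F))" for P Q
    using that by (cases P; cases Q) (simp; presburger)+
  from this[OF * refl refl] have abs: "\<bar>\<tau> i\<bar> = \<bar>\<tau> j\<bar>"
    and par: "(odd p \<noteq> (i \<in> F)) = (odd r \<noteq> (j \<in> F))" by auto
  have "i = j" by (rule signed_perm_abs_inject[OF \<tau> ij abs])
  with par have "odd p \<longleftrightarrow> odd r" by blast
  with \<open>i = j\<close> show "p = r" unfolding i_def j_def by presburger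
qed

lemma linked_inflate:
  assumes \<tau>: "\<tau> \<in> signed_perms n" and k: "k \<in> {1..n}"
  shows "linked (2 * n) (2 * int k - 1) (inflate n \<tau> F)"
proof -
  obtain i where i: "i \<in> {1..n}" "\<bar>\<tau> i\<bar> = int k"
    using signed_perm_position[OF \<tau>, of "int k"] k by auto
  have ps: "2 * i - 1 \<in> {1..2 * n}" "2 * i \<in> {1..2 * n}" and
    arith: "Suc (2 * i - 1) = 2 * i" "(2 * i - 1 + 1) div 2 = i" "(2 * i + 1) div 2 = i"
    "odd (2 * i - 1)"
    using i(1) by auto
  show ?thesis
    unfolding linked_def
  proof (intro bexI[of _ "2 * i - 1"] conjI)
    show "sgn (inflate n \<tau> F (2 * i - 1)) = sgn (inflate n \<tau> F (Suc (2 * i - 1)))"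
      unfolding arith(1) sgn_inflate[OF \<tau> ps(1)] sgn_inflate[OF \<tau> ps(2)] arith ..
    show "{\<bar>inflate n \<tau> F (2 * i - 1)\<bar>, \<bar>inflate n \<tau> F (Suc (2 * i - 1))\<bar>} =
        {2 * int k - 1, 2 * int k - 1 + 1}"
      unfolding arith(1) abs_inflate[OF \<tau> ps(1)] abs_inflate[OF \<tau> ps(2)] arith i(2)
      using arith(4) by auto
    show "2 * i - 1 \<in> {1..<2 * n}" using i(1) by auto
  qed
qed

text \<open>
  A block \<open>{2 * k - 1, 2 * k}\<close> has two elements only.
\<close>

lemma block_pigeonhole:
  fixes a b c :: int
  assumes "(a + 1) div 2 = (b + 1) div 2" "(b + 1) div 2 = (c + 1) div 2"
  shows "a = b \<or> a = c \<or> b = c"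
  using assms by presburger

text \<open>
  The linked pairs cover all positions by disjoint pairs of neighbours. A path has at most one
  perfect matching, and for the path on \<open>1, \<dots>, 2 * n\<close> it consists of the pairs \<open>{2 * i - 1, 2 * i}\<close>:
  from left to right, the partner of \<open>2 * i - 1\<close> cannot be on its left, where everything is matched.
\<close>

lemma linked_blocks:
  assumes \<pi>: "\<pi> \<in> signed_perms (2 * n)"
    and linked: "\<And>k. k \<in> {1..n} \<Longrightarrow> linked (2 * n) (2 * int k - 1) \<pi>"
    and i: "i \<in> {1..n}"
  shows "sgn (\<pi> (2 * i - 1)) = sgn (\<pi> (2 * i)) \<and>
    (\<bar>\<pi> (2 * i - 1)\<bar> + 1) div 2 = (\<bar>\<pi> (2 * i)\<bar> + 1) div 2"
proof -
  define c where "c p = (\<bar>\<pi> p\<bar> + 1) div 2" for p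
  \<comment> \<open>\<open>p\<close> and its right neighbour carry the two letters of one linked pair.\<close>
  define joined where "joined p \<longleftrightarrow> p \<in> {1..<2 * n} \<and> sgn (\<pi> p) = sgn (\<pi> (Suc p)) \<and> c p = c (Suc p)" for p
  have partner: "joined p \<or> (\<exists>p'. p = Suc p' \<and> joined p')" if p: "p \<in> {1..2 * n}" for p
  proof -
    define k where "k = nat (c p)"
    have k: "k \<in> {1..n}" "int k = c p"
      using signed_perm_abs_bounds[OF \<pi> p] by (auto simp: k_def c_def)
    obtain j where j: "j \<in> {1..<2 * n}" "sgn (\<pi> j) = sgn (\<pi> (Suc j))"
      "{\<bar>\<pi> j\<bar>, \<bar>\<pi> (Suc j)\<bar>} = {2 * int k - 1, 2 * int k - 1 + 1}"
      using linked[OF k(1)] unfolding linked_def by blast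
    have "c j = int k" "c (Suc j) = int k"
      using j(3) by (auto simp: c_def doubleton_eq_iff)
    then have "joined j" using j by (simp add: joined_def)
    have "\<bar>\<pi> p\<bar> = 2 * int k - 1 \<or> \<bar>\<pi> p\<bar> = 2 * int k - 1 + 1"
      using k(2) unfolding c_def by presburger
    then have "\<bar>\<pi> p\<bar> = \<bar>\<pi> j\<bar> \<or> \<bar>\<pi> p\<bar> = \<bar>\<pi> (Suc j)\<bar>"
      using j(3) by (auto simp: doubleton_eq_iff)
    then have "p = j \<or> p = Suc j"
      using signed_perm_abs_inject[OF \<pi> p, of j] signed_perm_abs_inject[OF \<pi> p, of "Suc j"] j(1)
      by auto
    with \<open>joined j\<close> show ?thesis by auto
  qed
  have no_three: "\<not> joined (Suc p)" if "joined p" for p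
  proof
    assume "joined (Suc p)"
    with that have ps: "p \<in> {1..2 * n}" "Suc p \<in> {1..2 * n}" "Suc (Suc p) \<in> {1..2 * n}"
      and "c p = c (Suc p)" "c (Suc p) = c (Suc (Suc p))"
      by (auto simp: joined_def)
    then have "\<bar>\<pi> p\<bar> = \<bar>\<pi> (Suc p)\<bar> \<or> \<bar>\<pi> p\<bar> = \<bar>\<pi> (Suc (Suc p))\<bar> \<or> \<bar>\<pi> (Suc p)\<bar> = \<bar>\<pi> (Suc (Suc p))\<bar>"
      unfolding c_def using block_pigeonhole by blast
    then show False
      using signed_perm_abs_inject[OF \<pi> ps(1,2)] signed_perm_abs_inject[OF \<pi> ps(1,3)]
        signed_perm_abs_inject[OF \<pi> ps(2,3)] by auto
  qed
  have "joined (2 * i - 1)"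
    using i
  proof (induction i)
    case (Suc i)
    have "joined (Suc (2 * i)) \<or> joined (2 * i)"
      using partner[of "Suc (2 * i)"] Suc.prems by auto
    moreover have "\<not> joined (2 * i)"
    proof (cases "i = 0")
      case True
      then show ?thesis by (simp add: joined_def)
    next
      case False
      then show ?thesis using no_three[of "2 * i - 1"] Suc by auto
    qed
    ultimately show ?case by simp
  qed simp
  moreover have "Suc (2 * i - 1) = 2 * i" using i by auto
  ultimately show ?thesis by (simp add: joined_def c_def)
qed

lemma deflate_inflate:
  assumes \<tau>: "\<tau> \<in> signed_perms n"
  shows "deflate n (inflate n \<tau> F) = \<tau>"
proof (rule extensionalityI)
  show "deflate n (inflate n \<tau> F) \<in> extensional {1..n}" by (simp add: deflate_def)
  show "\<tau> \<in> extensional {1..n}" by (rule signed_perm_extensional[OF \<tau>])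
  fix i assume i: "i \<in> {1..n}"
  then have p: "2 * i \<in> {1..2 * n}" by auto
  have "(\<bar>inflate n \<tau> F (2 * i)\<bar> + 1) div 2 = \<bar>\<tau> i\<bar>"
    unfolding abs_inflate[OF \<tau> p] by (auto simp: of_bool_def)
  then show "deflate n (inflate n \<tau> F) i = \<tau> i"
    using i sgn_inflate[OF \<tau> p, of F] by (simp add: deflate_def sgn_mult_abs)
qed

lemma abs_inflate_less_within_block:
  assumes "\<tau> \<in> signed_perms n" "i \<in> {1..n}"
  shows "\<bar>inflate n \<tau> F (2 * i)\<bar> < \<bar>inflate n \<tau> F (2 * i - 1)\<bar> \<longleftrightarrow> i \<in> F"
proof -
  have "\<bar>sgn (\<tau> i)\<bar> = 1" "\<bar>\<tau> i\<bar> \<ge> 1"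
    using signed_perm_abs_bounds[OF assms] by (auto simp: sgn_if)
  then show ?thesis unfolding inflate_odd[OF assms(2)] inflate_even[OF assms(2)] abs_mult by auto
qed

lemma flips_inflate:
  assumes \<tau>: "\<tau> \<in> signed_perms n" and F: "F \<subseteq> {1..n}"
  shows "flips n (inflate n \<tau> F) = F"
  using F abs_inflate_less_within_block[OF \<tau>] by (auto simp only: flips_def)

lemma inflate_deflate:
  assumes \<pi>: "\<pi> \<in> signed_perms (2 * n)"
    and linked: "\<And>k. k \<in> {1..n} \<Longrightarrow> linked (2 * n) (2 * int k - 1) \<pi>"
  shows "inflate n (deflate n \<pi>) (flips n \<pi>) = \<pi>"
proof (rule extensionalityI)
  show "inflate n (deflate n \<pi>) (flips n \<pi>) \<in> extensional {1..2 * n}" by (simp add: inflate_def)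
  show "\<pi> \<in> extensional {1..2 * n}" by (rule signed_perm_extensional[OF \<pi>])
  have block: "inflate n (deflate n \<pi>) (flips n \<pi>) (2 * i - 1) = \<pi> (2 * i - 1) \<and>
      inflate n (deflate n \<pi>) (flips n \<pi>) (2 * i) = \<pi> (2 * i)" if i: "i \<in> {1..n}" for i
  proof -
    define a b where "a = \<bar>\<pi> (2 * i - 1)\<bar>" and "b = \<bar>\<pi> (2 * i)\<bar>"
    define s where "s = sgn (\<pi> (2 * i))"
    have ps: "2 * i - 1 \<in> {1..2 * n}" "2 * i \<in> {1..2 * n}" "2 * i - 1 \<noteq> 2 * i" using i by auto
    have "b \<ge> 1" "a \<noteq> b"
      using signed_perm_abs_bounds[OF \<pi> ps(2)] signed_perm_abs_inject[OF \<pi> ps(1,2)] ps(3)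
      by (auto simp: a_def b_def)
    have blk: "sgn (\<pi> (2 * i - 1)) = s" "(a + 1) div 2 = (b + 1) div 2"
      using linked_blocks[OF \<pi> linked i] by (simp_all add: a_def b_def s_def)
    have s: "s * s = 1" using \<open>b \<ge> 1\<close> by (auto simp: s_def b_def sgn_if)
    have \<pi>_eq: "\<pi> (2 * i - 1) = s * a" "\<pi> (2 * i) = s * b"
      using sgn_mult_abs[of "\<pi> (2 * i - 1)"] sgn_mult_abs[of "\<pi> (2 * i)"] blk(1)
      by (simp_all add: a_def b_def s_def)
    have d: "deflate n \<pi> i = s * ((b + 1) div 2)"
      using i by (simp add: deflate_def s_def b_def)
    have "\<bar>deflate n \<pi> i\<bar> = (b + 1) div 2" "sgn (deflate n \<pi> i) = s"
      using \<open>b \<ge> 1\<close> s unfolding d by (auto simp: abs_mult sgn_mult s_def b_def sgn_if)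
    moreover have "i \<in> flips n \<pi> \<longleftrightarrow> b < a"
      using i by (simp add: flips_def a_def b_def)
    moreover have "2 * ((b + 1) div 2) - of_bool (\<not> b < a) = a" "2 * ((b + 1) div 2) - of_bool (b < a) = b"
      using blk(2) \<open>a \<noteq> b\<close> by (cases "b < a"; simp only: of_bool_eq not_True_eq_False not_False_eq_True; presburger)+
    ultimately show ?thesis
      unfolding inflate_odd[OF i] inflate_even[OF i] \<pi>_eq by simp
  qed
  fix p assume "p \<in> {1..2 * n}"
  then show "inflate n (deflate n \<pi>) (flips n \<pi>) p = \<pi> p"
    by (cases rule: block_cases) (use block in auto)
qed

lemma deflate_signed_perm:
  assumes \<pi>: "\<pi> \<in> signed_perms (2 * n)"
    and linked: "\<And>k. k \<in> {1..n} \<Longrightarrow> linked (2 * n) (2 * int k - 1) \<pi>"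
  shows "deflate n \<pi> \<in> signed_perms n"
proof (rule signed_permI)
  show "deflate n \<pi> \<in> extensional {1..n}" by (simp add: deflate_def)
  have abs: "\<bar>deflate n \<pi> i\<bar> = (\<bar>\<pi> (2 * i)\<bar> + 1) div 2" if i: "i \<in> {1..n}" for i
  proof -
    have "2 * i \<in> {1..2 * n}" using i by auto
    from signed_perm_abs_bounds[OF \<pi> this] show ?thesis
      using i by (simp add: deflate_def abs_mult sgn_if)
  qed
  show "1 \<le> \<bar>deflate n \<pi> i\<bar> \<and> \<bar>deflate n \<pi> i\<bar> \<le> int n" if i: "i \<in> {1..n}" for i
  proof -
    have "2 * i \<in> {1..2 * n}" using i by auto
    from signed_perm_abs_bounds[OF \<pi> this] show ?thesis
      unfolding abs[OF i] by auto
  qed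
  fix i j assume i: "i \<in> {1..n}" and j: "j \<in> {1..n}" and "\<bar>deflate n \<pi> i\<bar> = \<bar>deflate n \<pi> j\<bar>"
  then have "(\<bar>\<pi> (2 * i)\<bar> + 1) div 2 = (\<bar>\<pi> (2 * j)\<bar> + 1) div 2"
    "(\<bar>\<pi> (2 * i - 1)\<bar> + 1) div 2 = (\<bar>\<pi> (2 * i)\<bar> + 1) div 2"
    using linked_blocks[OF \<pi> linked i] by (simp_all add: abs)
  from block_pigeonhole[OF this(2,1)]
  have "\<bar>\<pi> (2 * i - 1)\<bar> = \<bar>\<pi> (2 * i)\<bar> \<or> \<bar>\<pi> (2 * i - 1)\<bar> = \<bar>\<pi> (2 * j)\<bar> \<or> \<bar>\<pi> (2 * i)\<bar> = \<bar>\<pi> (2 * j)\<bar>" .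
  moreover have "2 * i \<in> {1..2 * n}" "2 * i - 1 \<in> {1..2 * n}" "2 * j \<in> {1..2 * n}"
    using i j by auto
  ultimately have "2 * i - 1 = 2 * i \<or> 2 * i - 1 = 2 * j \<or> 2 * i = 2 * j"
    using signed_perm_abs_inject[OF \<pi>] by blast
  moreover have "1 \<le> i" using i by simp
  ultimately show "i = j" by presburger
qed

section \<open>Statistics of an inflation\<close>

lemma abs_inflate_bounds:
  assumes "\<tau> \<in> signed_perms n" "p \<in> {1..2 * n}"
  shows "2 * \<bar>\<tau> ((p + 1) div 2)\<bar> - 1 \<le> \<bar>inflate n \<tau> F p\<bar>"
    and "\<bar>inflate n \<tau> F p\<bar> \<le> 2 * \<bar>\<tau> ((p + 1) div 2)\<bar>"
proof -
  have "0 \<le> (of_bool (odd p \<noteq> ((p + 1) div 2 \<in> F)) :: int)"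
    "(of_bool (odd p \<noteq> ((p + 1) div 2 \<in> F)) :: int) \<le> 1" by simp_all
  then show "2 * \<bar>\<tau> ((p + 1) div 2)\<bar> - 1 \<le> \<bar>inflate n \<tau> F p\<bar>"
    "\<bar>inflate n \<tau> F p\<bar> \<le> 2 * \<bar>\<tau> ((p + 1) div 2)\<bar>"
    unfolding abs_inflate[OF assms] by linarith+
qed

lemma abs_inflate_less_across_blocks:
  assumes \<tau>: "\<tau> \<in> signed_perms n" and p: "p \<in> {1..2 * n}" and r: "r \<in> {1..2 * n}"
    and "(p + 1) div 2 \<noteq> (r + 1) div 2"
  shows "\<bar>inflate n \<tau> F r\<bar> < \<bar>inflate n \<tau> F p\<bar> \<longleftrightarrow> \<bar>\<tau> ((r + 1) div 2)\<bar> < \<bar>\<tau> ((p + 1) div 2)\<bar>"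
proof -
  have "(p + 1) div 2 \<in> {1..n}" "(r + 1) div 2 \<in> {1..n}" using p r by auto
  then have "\<bar>\<tau> ((p + 1) div 2)\<bar> \<noteq> \<bar>\<tau> ((r + 1) div 2)\<bar>"
    using signed_perm_abs_inject[OF \<tau>] assms(4) by blast
  with abs_inflate_bounds[OF \<tau> p, of F] abs_inflate_bounds[OF \<tau> r, of F] show ?thesis
    by linarith
qed

lemma inflate_neg_iff:
  assumes "\<tau> \<in> signed_perms n" "p \<in> {1..2 * n}"
  shows "inflate n \<tau> F p < 0 \<longleftrightarrow> \<tau> ((p + 1) div 2) < 0"
  using sgn_inflate[OF assms, of F] by (metis sgn_less)

lemma Neg_inflate:
  assumes \<tau>: "\<tau> \<in> signed_perms n"
  shows "Neg (2 * n) (inflate n \<tau> F) = (\<lambda>i. 2 * i - 1) ` Neg n \<tau> \<union> (\<lambda>i. 2 * i) ` Neg n \<tau>"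
    (is "?lhs = ?rhs")
proof
  show "?lhs \<subseteq> ?rhs"
  proof
    fix p assume "p \<in> ?lhs"
    then have p: "p \<in> {1..2 * n}" "\<tau> ((p + 1) div 2) < 0"
      using inflate_neg_iff[OF \<tau>] by (auto simp: Neg_def)
    from p(1) show "p \<in> ?rhs"
      by (cases rule: block_cases) (use p(2) in \<open>auto simp: Neg_def\<close>)
  qed
  show "?rhs \<subseteq> ?lhs"
  proof
    fix p assume "p \<in> ?rhs"
    then obtain i where i: "i \<in> {1..n}" "\<tau> i < 0" "p = 2 * i - 1 \<or> p = 2 * i"
      by (auto simp: Neg_def)
    then have "p \<in> {1..2 * n}" "(p + 1) div 2 = i" by auto
    with i(2) inflate_neg_iff[OF \<tau>, of p F] show "p \<in> ?lhs" by (simp add: Neg_def)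
  qed
qed

lemma odd_even_positions:
  fixes A B :: "nat set"
  assumes "A \<subseteq> {1..n}"
  shows "finite A" "inj_on (\<lambda>i. 2 * i - 1) A" "inj_on (\<lambda>i. 2 * i) B"
    "(\<lambda>i. 2 * i - 1) ` A \<inter> (\<lambda>i. 2 * i) ` B = {}"
proof -
  have pos: "1 \<le> i" if "i \<in> A" for i using that assms by auto
  show "finite A" using assms finite_subset by auto
  show "inj_on (\<lambda>i. 2 * i - 1) A"
  proof (rule inj_onI)
    fix i j assume "i \<in> A" "j \<in> A" and eq: "2 * i - 1 = 2 * j - 1"
    with pos[of i] pos[of j] show "i = j" by linarith
  qed
  show "inj_on (\<lambda>i. 2 * i) B" by (rule inj_onI) simp
  have "2 * i - 1 \<noteq> 2 * j" if "i \<in> A" for i j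
    using pos[OF that] by presburger
  then show "(\<lambda>i. 2 * i - 1) ` A \<inter> (\<lambda>i. 2 * i) ` B = {}" by auto
qed

lemma Neg_subset: "Neg N \<pi> \<subseteq> {1..N}"
  by (auto simp: Neg_def)

lemma prod_Neg_inflate:
  assumes "\<tau> \<in> signed_perms n"
  shows "prod xs (Neg (2 * n) (inflate n \<tau> F)) = (\<Prod>i\<in>Neg n \<tau>. xs (2 * i - 1) * xs (2 * i))"
  unfolding Neg_inflate[OF assms]
  using odd_even_positions[OF Neg_subset[of n \<tau>]]
  by (simp add: prod.union_disjoint prod.reindex prod.distrib)

lemma neg_inflate:
  assumes "\<tau> \<in> signed_perms n"
  shows "neg (2 * n) (inflate n \<tau> F) = 2 * neg n \<tau>"
  unfolding neg_def Neg_inflate[OF assms]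
  using odd_even_positions[OF Neg_subset[of n \<tau>]]
  by (simp add: card_Un_disjoint card_image)

text \<open>
  A descent inside a block is a flipped block, also when the letters are negative, since the flag
  order compares letters of equal sign by absolute value. Between blocks the comparison is that of
  the original letters.
\<close>

lemma Des_F_inflate:
  assumes \<tau>: "\<tau> \<in> signed_perms n" and F: "F \<subseteq> {1..n}"
  shows "Des_F (2 * n) (inflate n \<tau> F) = (\<lambda>i. 2 * i - 1) ` F \<union> (\<lambda>i. 2 * i) ` Des_F n \<tau>"
proof -
  have odd: "2 * i - 1 \<in> Des_F (2 * n) (inflate n \<tau> F) \<longleftrightarrow> i \<in> F" if i: "i \<in> {1..n}" for i
  proof -
    have ps: "2 * i - 1 \<in> {1..2 * n}" "2 * i \<in> {1..2 * n}"
      "(2 * i - 1 + 1) div 2 = i" "(2 * i + 1) div 2 = i" "2 * i - 1 + 1 = 2 * i"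
      "2 * i - 1 \<in> {1..2 * n - 1}"
      using i by auto
    have "\<tau> i \<noteq> 0" using signed_perm_abs_bounds[OF \<tau> i] by auto
    moreover have "sgn (inflate n \<tau> F (2 * i - 1)) = sgn (\<tau> i)" "sgn (inflate n \<tau> F (2 * i)) = sgn (\<tau> i)"
      using sgn_inflate[OF \<tau> ps(1)] sgn_inflate[OF \<tau> ps(2)] ps by simp_all
    ultimately have "flag_less (inflate n \<tau> F (2 * i)) (inflate n \<tau> F (2 * i - 1)) \<longleftrightarrow>
        \<bar>inflate n \<tau> F (2 * i)\<bar> < \<bar>inflate n \<tau> F (2 * i - 1)\<bar>"
      unfolding flag_less_def by (metis less_asym sgn_greater sgn_less)
    then show ?thesis
      using ps abs_inflate_less_within_block[OF \<tau> i] unfolding Des_F_def by simp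
  qed
  have even: "2 * i \<in> Des_F (2 * n) (inflate n \<tau> F) \<longleftrightarrow> i \<in> Des_F n \<tau>" if i: "i \<in> {1..n}" for i
  proof (cases "i = n")
    case True
    then show ?thesis using i by (auto simp: Des_F_def)
  next
    case False
    then have ps: "2 * i \<in> {1..2 * n}" "2 * i + 1 \<in> {1..2 * n}" "(2 * i + 1) div 2 = i"
      "(2 * i + 1 + 1) div 2 = i + 1" "2 * i \<in> {1..2 * n - 1}" "i \<in> {1..n - 1}"
      using i by auto
    have "sgn (inflate n \<tau> F (2 * i)) = sgn (\<tau> i)" "sgn (inflate n \<tau> F (2 * i + 1)) = sgn (\<tau> (i + 1))"
      using sgn_inflate[OF \<tau> ps(1)] sgn_inflate[OF \<tau> ps(2)] unfolding ps by simp_all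
    moreover have "\<bar>inflate n \<tau> F (2 * i + 1)\<bar> < \<bar>inflate n \<tau> F (2 * i)\<bar> \<longleftrightarrow> \<bar>\<tau> (i + 1)\<bar> < \<bar>\<tau> i\<bar>"
      using abs_inflate_less_across_blocks[OF \<tau> ps(1,2), of F] unfolding ps by simp
    ultimately have "flag_less (inflate n \<tau> F (2 * i + 1)) (inflate n \<tau> F (2 * i)) \<longleftrightarrow>
        flag_less (\<tau> (i + 1)) (\<tau> i)"
      unfolding flag_less_def by (metis sgn_greater sgn_less)
    then show ?thesis using ps by (simp add: Des_F_def)
  qed
  show ?thesis (is "?lhs = ?rhs")
  proof
    show "?lhs \<subseteq> ?rhs"
    proof
      fix p assume p: "p \<in> ?lhs"
      then have "p \<in> {1..2 * n}" by (auto simp: Des_F_def)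
      then show "p \<in> ?rhs" by (cases rule: block_cases) (use p odd even in auto)
    qed
    have "Des_F n \<tau> \<subseteq> {1..n}" by (auto simp: Des_F_def)
    with F odd even show "?rhs \<subseteq> ?lhs" by blast
  qed
qed

lemma des_F_inflate:
  assumes "\<tau> \<in> signed_perms n" "F \<subseteq> {1..n}"
  shows "des_F (2 * n) (inflate n \<tau> F) = card F + des_F n \<tau>"
  unfolding des_F_def Des_F_inflate[OF assms]
  using odd_even_positions[OF assms(2)]
  by (simp add: card_Un_disjoint finite_Des_F card_image)

lemma maj_F_inflate:
  assumes "\<tau> \<in> signed_perms n" "F \<subseteq> {1..n}"
  shows "maj_F (2 * n) (inflate n \<tau> F) = (\<Sum>i\<in>F. 2 * i - 1) + 2 * maj_F n \<tau>"
  unfolding maj_F_def Des_F_inflate[OF assms]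
  using odd_even_positions[OF assms(2)]
  by (simp add: sum.union_disjoint finite_Des_F sum.reindex sum_distrib_left)

lemma fdes_inflate:
  assumes \<tau>: "\<tau> \<in> signed_perms n" and F: "F \<subseteq> {1..n}" and "1 \<le> n"
  shows "fdes (2 * n) (inflate n \<tau> F) = 2 * card F + fdes n \<tau>"
proof -
  have "inflate n \<tau> F 1 < 0 \<longleftrightarrow> \<tau> 1 < 0"
    using inflate_neg_iff[OF \<tau>, of 1 F] \<open>1 \<le> n\<close> by simp
  then show ?thesis by (simp add: fdes_def des_F_inflate[OF \<tau> F])
qed

lemma fmaj_inflate:
  assumes "\<tau> \<in> signed_perms n" "F \<subseteq> {1..n}"
  shows "fmaj (2 * n) (inflate n \<tau> F) = (\<Sum>i\<in>F. 4 * i - 2) + 2 * fmaj n \<tau>"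
proof -
  have "2 * (\<Sum>i\<in>F. 2 * i - 1) = (\<Sum>i\<in>F. 4 * i - 2)"
    unfolding sum_distrib_left by (intro sum.cong) auto
  then show ?thesis
    by (simp only: fmaj_def maj_F_inflate[OF assms] neg_inflate[OF assms(1)] add_mult_distrib2)
qed

text \<open>
  A flipped block is an inversion in itself. An inversion of \<open>\<bar>\<tau>\<bar>\<close> turns into the four pairs that
  take one position from each of its two blocks.
\<close>

lemma inversions_inflate:
  assumes \<tau>: "\<tau> \<in> signed_perms n" and F: "F \<subseteq> {1..n}"
  shows "inversions (2 * n) (\<lambda>i. \<bar>inflate n \<tau> F i\<bar>) = card F + 4 * inversions n (\<lambda>i. \<bar>\<tau> i\<bar>)"
proof -
  define A where "A p = \<bar>inflate n \<tau> F p\<bar>" for p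
  define b :: "nat \<Rightarrow> nat" where "b p = (p + 1) div 2" for p
  define I where "I = {(i, j). i \<in> {1..n} \<and> j \<in> {1..n} \<and> i < j \<and> \<bar>\<tau> i\<bar> > \<bar>\<tau> j\<bar>}"
  \<comment> \<open>\<open>k\<close> and \<open>l\<close> choose the positions within the blocks \<open>i\<close> and \<open>j\<close>.\<close>
  define f where "f = (\<lambda>((i, j), k, l). (2 * i - k, 2 * j - l) :: nat \<times> nat)"
  have block: "p = 2 * b p - 1" "r = 2 * b p" if "p < r" "b p = b r" for p r
    using that unfolding b_def by presburger+
  have block_of: "b (2 * i - k) = i" if "1 \<le> i" "k \<in> {0, 1}" for i k
    using that by (auto simp: b_def)
  have within: "A p > A r \<longleftrightarrow> b p \<in> F" if "p \<in> {1..2 * n}" "p < r" "b p = b r" for p r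
  proof -
    have "b p \<in> {1..n}" using that by (auto simp: b_def)
    then show ?thesis
      using abs_inflate_less_within_block[OF \<tau>, of "b p" F] block[OF that(2,3)]
      unfolding A_def by metis
  qed
  have across: "A p > A r \<longleftrightarrow> (b p, b r) \<in> I"
    if "p \<in> {1..2 * n}" "r \<in> {1..2 * n}" "p < r" "b p \<noteq> b r" for p r
  proof -
    have "b p \<in> {1..n}" "b r \<in> {1..n}" using that by (auto simp: b_def)
    moreover have "b p \<le> b r" unfolding b_def using that(3) by (intro div_le_mono) simp
    ultimately show ?thesis
      using abs_inflate_less_across_blocks[OF \<tau> that(1,2), of F] that(4)
      unfolding A_def I_def b_def by auto
  qed
  have eq: "{(p, r). p \<in> {1..2 * n} \<and> r \<in> {1..2 * n} \<and> p < r \<and> A p > A r} =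
      (\<lambda>i. (2 * i - 1, 2 * i)) ` F \<union> f ` (I \<times> {0, 1} \<times> {0, 1})" (is "?lhs = ?flipped \<union> ?far")
  proof (intro set_eqI iffI)
    fix x assume "x \<in> ?lhs"
    then obtain p r where x: "x = (p, r)" and pr: "p \<in> {1..2 * n}" "r \<in> {1..2 * n}" "p < r" "A p > A r"
      by auto
    show "x \<in> ?flipped \<union> ?far"
    proof (cases "b p = b r")
      case True
      have "(p, r) = (2 * b p - 1, 2 * b p)" using block[OF pr(3) True] by simp
      moreover have "b p \<in> F" using within[OF pr(1,3) True] pr(4) by blast
      ultimately show ?thesis unfolding x by (rule image_eqI[THEN UnI1])
    next
      case False
      then have I: "(b p, b r) \<in> I" using across pr by blast
      have k: "2 * b p - (2 * b p - p) = p" "2 * b p - p = 0 \<or> 2 * b p - p = 1" for p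
        unfolding b_def by presburger+
      have "(p, r) = f ((b p, b r), 2 * b p - p, 2 * b r - r)"
        by (simp add: f_def k)
      moreover have "((b p, b r), 2 * b p - p, 2 * b r - r) \<in> I \<times> {0, 1} \<times> {0, 1}"
        using I k(2)[of p] k(2)[of r] by blast
      ultimately show ?thesis unfolding x by (rule image_eqI[THEN UnI2])
    qed
  next
    fix x assume "x \<in> ?flipped \<union> ?far"
    then show "x \<in> ?lhs"
    proof
      assume "x \<in> ?flipped"
      then obtain i where i: "i \<in> F" "x = (2 * i - 1, 2 * i)" by auto
      with F have "i \<in> {1..n}" by auto
      then have "2 * i - 1 \<in> {1..2 * n}" "2 * i \<in> {1..2 * n}" "2 * i - 1 < 2 * i"
        "b (2 * i - 1) = i" "b (2 * i) = i"
        by (auto simp: b_def)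
      then show ?thesis using i within[of "2 * i - 1" "2 * i"] by auto
    next
      assume "x \<in> ?far"
      then obtain i j k l where x: "x = (2 * i - k, 2 * j - l)" and I: "(i, j) \<in> I"
        and kl: "k \<in> {0, 1}" "l \<in> {0, 1}"
        unfolding f_def by auto
      then have ij: "1 \<le> i" "i < j" "j \<le> n" by (auto simp: I_def)
      have "2 * i - k \<in> {1..2 * n}" "2 * j - l \<in> {1..2 * n}" "2 * i - k < 2 * j - l"
        "b (2 * i - k) = i" "b (2 * j - l) = j"
        using ij kl by (auto simp: b_def)
      then show ?thesis using I ij(2) across[of "2 * i - k" "2 * j - l"] unfolding x by simp
    qed
  qed
  have "finite I"
    by (rule finite_subset[of _ "{1..n} \<times> {1..n}"]) (auto simp: I_def)
  moreover have "finite F" using F finite_subset by auto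
  ultimately have fin: "finite F" "finite I" by auto
  have inj_f: "inj_on f (I \<times> {0, 1} \<times> {0, 1})"
  proof (rule inj_onI)
    fix u v assume u: "u \<in> I \<times> {0, 1} \<times> {0, 1}" and v: "v \<in> I \<times> {0, 1} \<times> {0, 1}" and "f u = f v"
    have half: "i = i' \<and> k = k'"
      if "2 * i - k = 2 * i' - k'" "1 \<le> i" "1 \<le> i'" "k \<in> {0, 1}" "k' \<in> {0, 1}" for i i' k k' :: nat
    proof -
      have "i = i'" using block_of[OF that(2,4)] block_of[OF that(3,5)] that(1) by simp
      with that show ?thesis by auto
    qed
    obtain i j k l i' j' k' l' where uv: "u = ((i, j), k, l)" "v = ((i', j'), k', l')"
      by (metis prod.exhaust)
    then have "2 * i - k = 2 * i' - k'" "2 * j - l = 2 * j' - l'"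
      using \<open>f u = f v\<close> by (simp_all add: f_def)
    with u v show "u = v"
      unfolding uv using half[of i k i' k'] half[of j l j' l'] by (auto simp: I_def)
  qed
  have disj: "?flipped \<inter> ?far = {}"
  proof (rule equals0I)
    fix x assume "x \<in> ?flipped \<inter> ?far"
    then have "x \<in> ?flipped" "x \<in> ?far" by (fact IntD1, fact IntD2)
    from this(1) obtain m where m: "m \<in> F" "x = (2 * m - 1, 2 * m)" by auto
    from \<open>x \<in> ?far\<close> obtain i j k l where x: "x = (2 * i - k, 2 * j - l)" and I: "(i, j) \<in> I"
      and kl: "k \<in> {0, 1}" "l \<in> {0, 1}"
      unfolding f_def by auto
    have pos: "1 \<le> m" "1 \<le> i" "1 \<le> j" "i < j" using m(1) I F by (auto simp: I_def)
    have "i = b (2 * m - 1)" using block_of[OF pos(2) kl(1)] m(2) x by (metis prod.inject)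
    moreover have "j = b (2 * m - 0)"
      using block_of[OF pos(3) kl(2)] m(2) x by (metis prod.inject diff_zero)
    ultimately show False
      using block_of[OF pos(1), of 0] block_of[OF pos(1), of 1] pos(4) by simp
  qed
  have "inversions (2 * n) (\<lambda>i. \<bar>inflate n \<tau> F i\<bar>) = card (?flipped \<union> ?far)"
    unfolding inversions_def eq[symmetric] A_def ..
  also have "\<dots> = card ?flipped + card ?far"
    using fin disj by (intro card_Un_disjoint) auto
  also have "card ?flipped = card F"
    by (rule card_image) (auto intro: inj_onI)
  also have "card ?far = 4 * card I"
    unfolding card_image[OF inj_f] by (simp add: card_cartesian_product)
  finally show ?thesis by (simp add: inversions_def I_def)
qed

section \<open>The generating functions\<close>

text \<open>
  The letter \<open>\<tau> i\<close> passes its sign to the positions \<open>2 * i - 1\<close> and \<open>2 * i\<close>, so the sign must be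
  admissible for both. This is where the intersection of the two sign sets comes from.
\<close>

lemma bij_betw_inflate:
  assumes S: "\<And>i. i \<in> {1..n} \<Longrightarrow> S i = H (2 * i - 1) \<inter> H (2 * i)"
  shows "bij_betw (\<lambda>(\<tau>, F). inflate n \<tau> F) (restricted_signed_perms n S \<times> Pow {1..n})
    {\<pi> \<in> restricted_signed_perms (2 * n) H. \<forall>k\<in>{1..n}. linked (2 * n) (2 * int k - 1) \<pi>}"
    (is "bij_betw _ ?A ?B")
proof (rule bij_betw_byWitness[where f' = "\<lambda>\<pi>. (deflate n \<pi>, flips n \<pi>)"])
  show "\<forall>x\<in>?A. (\<lambda>\<pi>. (deflate n \<pi>, flips n \<pi>)) ((\<lambda>(\<tau>, F). inflate n \<tau> F) x) = x"
    by (auto simp: restricted_signed_perms_def deflate_inflate flips_inflate)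
  show recover: "\<forall>\<pi>\<in>?B. (\<lambda>(\<tau>, F). inflate n \<tau> F) (deflate n \<pi>, flips n \<pi>) = \<pi>"
  proof
    fix \<pi> assume \<pi>: "\<pi> \<in> ?B"
    then have "\<pi> \<in> signed_perms (2 * n)" by (simp add: restricted_signed_perms_def)
    moreover have "linked (2 * n) (2 * int k - 1) \<pi>" if "k \<in> {1..n}" for k
      using \<pi> that by blast
    ultimately have "inflate n (deflate n \<pi>) (flips n \<pi>) = \<pi>" by (rule inflate_deflate)
    then show "(\<lambda>(\<tau>, F). inflate n \<tau> F) (deflate n \<pi>, flips n \<pi>) = \<pi>" by simp
  qed
  have sign: "sign_of (inflate n \<tau> F (2 * i - 1)) = sign_of (\<tau> i)"
    "sign_of (inflate n \<tau> F (2 * i)) = sign_of (\<tau> i)"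
    if "\<tau> \<in> signed_perms n" "i \<in> {1..n}" for \<tau> F i
  proof -
    have "2 * i - 1 \<in> {1..2 * n}" "2 * i \<in> {1..2 * n}" "(2 * i - 1 + 1) div 2 = i" "(2 * i + 1) div 2 = i"
      using that(2) by auto
    then show "sign_of (inflate n \<tau> F (2 * i - 1)) = sign_of (\<tau> i)"
      "sign_of (inflate n \<tau> F (2 * i)) = sign_of (\<tau> i)"
      using inflate_neg_iff[OF that(1), of "2 * i - 1" F] inflate_neg_iff[OF that(1), of "2 * i" F]
      by (simp_all add: sign_of_def)
  qed
  have restricted: "inflate n \<tau> F \<in> restricted_signed_perms (2 * n) H \<longleftrightarrow>
      \<tau> \<in> restricted_signed_perms n S" if \<tau>: "\<tau> \<in> signed_perms n" for \<tau> F
  proof -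
    have "(\<forall>p\<in>{1..2 * n}. sign_of (inflate n \<tau> F p) \<in> H p) \<longleftrightarrow>
        (\<forall>i\<in>{1..n}. sign_of (\<tau> i) \<in> H (2 * i - 1) \<and> sign_of (\<tau> i) \<in> H (2 * i))" (is "?l \<longleftrightarrow> ?r")
    proof
      assume l: ?l
      show ?r
      proof
        fix i assume i: "i \<in> {1..n}"
        then have "2 * i - 1 \<in> {1..2 * n}" "2 * i \<in> {1..2 * n}" by auto
        with l sign[OF \<tau> i, of F] show "sign_of (\<tau> i) \<in> H (2 * i - 1) \<and> sign_of (\<tau> i) \<in> H (2 * i)"
          by metis
      qed
    next
      assume r: ?r
      show ?l
      proof
        fix p assume "p \<in> {1..2 * n}"
        then show "sign_of (inflate n \<tau> F p) \<in> H p"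
          by (cases rule: block_cases) (use r sign[OF \<tau>, of _ F] in auto)
      qed
    qed
    then show ?thesis
      using \<tau> S inflate_signed_perm[OF \<tau>] by (auto simp: restricted_signed_perms_def)
  qed
  show "(\<lambda>(\<tau>, F). inflate n \<tau> F) ` ?A \<subseteq> ?B"
  proof clarify
    fix \<tau> F assume "\<tau> \<in> restricted_signed_perms n S"
    moreover from this have "\<tau> \<in> signed_perms n" by (simp add: restricted_signed_perms_def)
    ultimately show "inflate n \<tau> F \<in> restricted_signed_perms (2 * n) H \<and>
        (\<forall>k\<in>{1..n}. linked (2 * n) (2 * int k - 1) (inflate n \<tau> F))"
      using restricted linked_inflate by blast
  qed
  show "(\<lambda>\<pi>. (deflate n \<pi>, flips n \<pi>)) ` ?B \<subseteq> ?A"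
  proof (rule image_subsetI)
    fix \<pi> assume \<pi>: "\<pi> \<in> ?B"
    then have "\<pi> \<in> signed_perms (2 * n)" by (simp add: restricted_signed_perms_def)
    moreover have "linked (2 * n) (2 * int k - 1) \<pi>" if "k \<in> {1..n}" for k
      using \<pi> that by blast
    ultimately have "deflate n \<pi> \<in> signed_perms n" by (rule deflate_signed_perm)
    moreover have "inflate n (deflate n \<pi>) (flips n \<pi>) = \<pi>" using recover \<pi> by auto
    ultimately have "deflate n \<pi> \<in> restricted_signed_perms n S"
      using restricted[of "deflate n \<pi>" "flips n \<pi>"] \<pi> by auto
    moreover have "flips n \<pi> \<subseteq> {1..n}" by (auto simp: flips_def)
    ultimately show "(deflate n \<pi>, flips n \<pi>) \<in> ?A" by simp
  qed
qed

text \<open>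
  After the cancellation the sum runs over the pairs of some \<open>\<tau>\<close> and a set \<open>F\<close> of flipped blocks.
  Flipping block \<open>i\<close> changes the sign and creates a flag descent at \<open>2 * i - 1\<close>, which is worth
  \<open>- t\<^sup>2 q\<^bsup>4i - 2\<^esup>\<close>. The sum over \<open>F\<close> is therefore an expanded product.
\<close>

lemma sum_sign_abs:
  fixes t q :: "'a::comm_ring_1" and xs :: "nat \<Rightarrow> 'a"
  assumes n: "1 \<le> n" and S: "\<And>i. i \<in> {1..n} \<Longrightarrow> S i = H (2 * i - 1) \<inter> H (2 * i)"
  shows "(\<Sum>\<pi>\<in>restricted_signed_perms (2 * n) H.
      (-1) ^ inversions (2 * n) (\<lambda>i. \<bar>\<pi> i\<bar>) * t ^ fdes (2 * n) \<pi> * q ^ fmaj (2 * n) \<pi>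
        * (\<Prod>i\<in>Neg (2 * n) \<pi>. xs i)) =
    (\<Prod>i=1..n. 1 - t ^ 2 * q ^ (4 * i - 2)) *
      (\<Sum>\<pi>\<in>restricted_signed_perms n S.
        t ^ fdes n \<pi> * q ^ (2 * fmaj n \<pi>) * (\<Prod>i\<in>Neg n \<pi>. xs (2 * i - 1) * xs (2 * i)))"
    (is "?lhs = ?P * sum ?g ?R")
proof -
  \<comment> \<open>The weight as a function of \<open>E = Neg\<close> and \<open>D = Des_F\<close>; \<open>1 \<in> E\<close> says that the first letter is negative.\<close>
  define w where "w E D = t ^ (2 * card D + of_bool (1 \<in> E)) * q ^ (2 * \<Sum>D + card E) * prod xs E"
    for E D :: "nat set"
  define h where "h \<pi> = (-1) ^ inversions (2 * n) (\<lambda>i. \<bar>\<pi> i\<bar>) * w (Neg (2 * n) \<pi>) (Des_F (2 * n) \<pi>)"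
    for \<pi>
  have h: "h \<pi> = (-1) ^ inversions (2 * n) (\<lambda>i. \<bar>\<pi> i\<bar>) * t ^ fdes (2 * n) \<pi> * q ^ fmaj (2 * n) \<pi>
      * prod xs (Neg (2 * n) \<pi>)" for \<pi>
    using n by (simp add: h_def w_def fdes_def des_F_def fmaj_def maj_F_def neg_def Neg_def mult.assoc)
  have inflate: "h (inflate n \<tau> F) =
      ((-1) ^ card F * (\<Prod>i\<in>F. t ^ 2 * q ^ (4 * i - 2)) * (\<Prod>i\<in>{1..n} - F. 1)) * ?g \<tau>"
    if "\<tau> \<in> ?R" "F \<in> Pow {1..n}" for \<tau> F
  proof -
    have \<tau>: "\<tau> \<in> signed_perms n" and F: "F \<subseteq> {1..n}"
      using that by (auto simp: restricted_signed_perms_def)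
    have "(-1 :: 'a) ^ (card F + 4 * k) = (-1) ^ card F" for k
      by (simp add: power_add power_mult)
    moreover have "(\<Prod>i\<in>F. t ^ 2 * q ^ (4 * i - 2)) = t ^ (2 * card F) * q ^ (\<Sum>i\<in>F. 4 * i - 2)"
      by (simp add: prod.distrib power_sum power_mult)
    ultimately show ?thesis
      unfolding h inversions_inflate[OF \<tau> F] fdes_inflate[OF \<tau> F n] fmaj_inflate[OF \<tau> F]
        prod_Neg_inflate[OF \<tau>]
      by (simp add: power_add ac_simps)
  qed
  have "?lhs = sum h (restricted_signed_perms (2 * n) H)" by (simp add: h)
  also have "\<dots> = sum h {\<pi> \<in> restricted_signed_perms (2 * n) H.
      \<forall>k\<in>{1..n}. linked (2 * n) (2 * int k - 1) \<pi>}"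
    unfolding h_def by (rule sum_eq_sum_all_linked) simp
  also have "\<dots> = (\<Sum>(\<tau>, F)\<in>?R \<times> Pow {1..n}. h (inflate n \<tau> F))"
    using sum.reindex_bij_betw[OF bij_betw_inflate[of n S H, OF S], of h] by (simp add: case_prod_unfold)
  also have "\<dots> = (\<Sum>\<tau>\<in>?R. \<Sum>F\<in>Pow {1..n}. h (inflate n \<tau> F))"
    by (rule sum.cartesian_product[symmetric])
  also have "\<dots> = (\<Sum>\<tau>\<in>?R. ?P * ?g \<tau>)"
  proof (intro sum.cong refl)
    fix \<tau> assume \<tau>: "\<tau> \<in> ?R"
    have "?P = (\<Sum>F\<in>Pow {1..n}.
        (-1) ^ card F * (\<Prod>i\<in>F. t ^ 2 * q ^ (4 * i - 2)) * (\<Prod>i\<in>{1..n} - F. 1))"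
      by (rule prod_diff_conv_sum) simp
    then show "(\<Sum>F\<in>Pow {1..n}. h (inflate n \<tau> F)) = ?P * ?g \<tau>"
      by (simp only: sum_distrib_right) (intro sum.cong refl inflate \<tau>)
  qed
  finally show ?thesis by (simp add: sum_distrib_left)
qed

text \<open>
  The extra sign \<open>(-1)\<close> per negative letter is absorbed by replacing \<open>xs i\<close> with \<open>- xs i\<close>. On the
  right-hand side these variables occur in pairs.
\<close>

lemma sum_sign_length_B:
  fixes t q :: "'a::comm_ring_1" and xs :: "nat \<Rightarrow> 'a"
  assumes "1 \<le> n" "\<And>i. i \<in> {1..n} \<Longrightarrow> S i = H (2 * i - 1) \<inter> H (2 * i)"
  shows "(\<Sum>\<pi>\<in>restricted_signed_perms (2 * n) H.
      (-1) ^ length_B (2 * n) \<pi> * t ^ fdes (2 * n) \<pi> * q ^ fmaj (2 * n) \<pi>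
        * (\<Prod>i\<in>Neg (2 * n) \<pi>. xs i)) =
    (\<Prod>i=1..n. 1 - t ^ 2 * q ^ (4 * i - 2)) *
      (\<Sum>\<pi>\<in>restricted_signed_perms n S.
        t ^ fdes n \<pi> * q ^ (2 * fmaj n \<pi>) * (\<Prod>i\<in>Neg n \<pi>. xs (2 * i - 1) * xs (2 * i)))"
proof -
  have "(-1) ^ length_B (2 * n) \<pi> * t ^ fdes (2 * n) \<pi> * q ^ fmaj (2 * n) \<pi>
        * (\<Prod>i\<in>Neg (2 * n) \<pi>. xs i) =
      (-1) ^ inversions (2 * n) (\<lambda>i. \<bar>\<pi> i\<bar>) * t ^ fdes (2 * n) \<pi> * q ^ fmaj (2 * n) \<pi>
        * (\<Prod>i\<in>Neg (2 * n) \<pi>. - xs i)" if "\<pi> \<in> restricted_signed_perms (2 * n) H" for \<pi>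
    using that by (simp add: restricted_signed_perms_def sign_length_B prod_uminus neg_def ac_simps)
  then show ?thesis
    using sum_sign_abs[OF assms, where xs = "\<lambda>i. - xs i" and t = t and q = q] by simp
qed

lemma sign_neg_power_fmaj:
  "(-1) ^ neg n \<pi> * q ^ fmaj n \<pi> = (- q :: 'a::comm_ring_1) ^ fmaj n \<pi>"
  unfolding power_minus[of q] by (simp add: fmaj_def power_add power_mult)

lemma restricted_signed_perms_UNIV: "restricted_signed_perms N (\<lambda>_. UNIV) = signed_perms N"
  by (simp add: restricted_signed_perms_def)

theorem corollary3p1:
  fixes n :: nat and t q x :: "'a::comm_ring_1" and xs :: "nat \<Rightarrow> 'a"
  assumes "n \<ge> 1"
  shows
    "(\<forall>H S :: nat \<Rightarrow> sign set.
        (\<forall>i\<in>{1..2 * n}. H i \<noteq> {}) \<longrightarrow>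
        (\<forall>i\<in>{1..n}. S i = H (2 * i - 1) \<inter> H (2 * i)) \<longrightarrow>
        (\<Sum>\<pi>\<in>restricted_signed_perms (2 * n) H.
            (-1) ^ length_B (2 * n) \<pi> * t ^ fdes (2 * n) \<pi> * q ^ fmaj (2 * n) \<pi>
              * (\<Prod>i\<in>Neg (2 * n) \<pi>. xs i))
          = (\<Prod>i=1..n. 1 - t ^ 2 * q ^ (4 * i - 2)) *
            (\<Sum>\<pi>\<in>restricted_signed_perms n S.
                t ^ fdes n \<pi> * q ^ (2 * fmaj n \<pi>)
                  * (\<Prod>i\<in>Neg n \<pi>. xs (2 * i - 1) * xs (2 * i)))
        \<and>
        (\<Sum>\<pi>\<in>restricted_signed_perms (2 * n) H.
            (-1) ^ inversions (2 * n) (\<lambda>i. \<bar>\<pi> i\<bar>) * t ^ fdes (2 * n) \<pi> * q ^ fmaj (2 * n) \<pi>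
              * (\<Prod>i\<in>Neg (2 * n) \<pi>. xs i))
          = (\<Prod>i=1..n. 1 - t ^ 2 * q ^ (4 * i - 2)) *
            (\<Sum>\<pi>\<in>restricted_signed_perms n S.
                t ^ fdes n \<pi> * q ^ (2 * fmaj n \<pi>)
                  * (\<Prod>i\<in>Neg n \<pi>. xs (2 * i - 1) * xs (2 * i))))
     \<and>
     (\<forall>S :: nat \<Rightarrow> sign set.
        (\<forall>i\<in>{1..n}. S i \<noteq> {}) \<longrightarrow>
        (\<Sum>\<pi>\<in>restricted_signed_perms n S.
            (-1) ^ neg n \<pi> * t ^ fdes n \<pi> * q ^ fmaj n \<pi> * (\<Prod>i\<in>Neg n \<pi>. xs i))
          = (\<Sum>\<pi>\<in>restricted_signed_perms n S.
                t ^ fdes n \<pi> * (- q) ^ fmaj n \<pi> * (\<Prod>i\<in>Neg n \<pi>. xs i)))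
     \<and>
     (\<Sum>\<pi>\<in>signed_perms (2 * n).
         (-1) ^ length_B (2 * n) \<pi> * t ^ fdes (2 * n) \<pi> * q ^ fmaj (2 * n) \<pi>
           * x ^ neg (2 * n) \<pi>)
       = (\<Prod>i=1..n. 1 - t ^ 2 * q ^ (4 * i - 2)) *
         (\<Sum>\<pi>\<in>signed_perms n. t ^ fdes n \<pi> * q ^ (2 * fmaj n \<pi>) * x ^ (2 * neg n \<pi>))
     \<and>
     (\<Sum>\<pi>\<in>signed_perms (2 * n).
         (-1) ^ inversions (2 * n) (\<lambda>i. \<bar>\<pi> i\<bar>) * t ^ fdes (2 * n) \<pi> * q ^ fmaj (2 * n) \<pi>
           * x ^ neg (2 * n) \<pi>)
       = (\<Prod>i=1..n. 1 - t ^ 2 * q ^ (4 * i - 2)) *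
         (\<Sum>\<pi>\<in>signed_perms n. t ^ fdes n \<pi> * q ^ (2 * fmaj n \<pi>) * x ^ (2 * neg n \<pi>))
     \<and>
     (\<Sum>\<pi>\<in>signed_perms n.
         (-1) ^ neg n \<pi> * t ^ fdes n \<pi> * q ^ fmaj n \<pi> * x ^ neg n \<pi>)
       = (\<Sum>\<pi>\<in>signed_perms n. t ^ fdes n \<pi> * (- q) ^ fmaj n \<pi> * x ^ neg n \<pi>)"
proof (intro conjI allI impI)
  fix H S :: "nat \<Rightarrow> sign set"
  assume S: "\<forall>i\<in>{1..n}. S i = H (2 * i - 1) \<inter> H (2 * i)"
  show "(\<Sum>\<pi>\<in>restricted_signed_perms (2 * n) H.
            (-1) ^ length_B (2 * n) \<pi> * t ^ fdes (2 * n) \<pi> * q ^ fmaj (2 * n) \<pi>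
              * (\<Prod>i\<in>Neg (2 * n) \<pi>. xs i))
          = (\<Prod>i=1..n. 1 - t ^ 2 * q ^ (4 * i - 2)) *
            (\<Sum>\<pi>\<in>restricted_signed_perms n S.
                t ^ fdes n \<pi> * q ^ (2 * fmaj n \<pi>)
                  * (\<Prod>i\<in>Neg n \<pi>. xs (2 * i - 1) * xs (2 * i)))"
    by (rule sum_sign_length_B) (use assms S in auto)
  show "(\<Sum>\<pi>\<in>restricted_signed_perms (2 * n) H.
            (-1) ^ inversions (2 * n) (\<lambda>i. \<bar>\<pi> i\<bar>) * t ^ fdes (2 * n) \<pi> * q ^ fmaj (2 * n) \<pi>
              * (\<Prod>i\<in>Neg (2 * n) \<pi>. xs i))
          = (\<Prod>i=1..n. 1 - t ^ 2 * q ^ (4 * i - 2)) *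
            (\<Sum>\<pi>\<in>restricted_signed_perms n S.
                t ^ fdes n \<pi> * q ^ (2 * fmaj n \<pi>)
                  * (\<Prod>i\<in>Neg n \<pi>. xs (2 * i - 1) * xs (2 * i)))"
    by (rule sum_sign_abs) (use assms S in auto)
next
  have const: "(\<Prod>i\<in>Neg n \<pi>. x * x) = x ^ (2 * neg n \<pi>)" for \<pi>
    by (simp add: neg_def power_mult power2_eq_square)
  show "(\<Sum>\<pi>\<in>signed_perms (2 * n).
         (-1) ^ length_B (2 * n) \<pi> * t ^ fdes (2 * n) \<pi> * q ^ fmaj (2 * n) \<pi>
           * x ^ neg (2 * n) \<pi>)
       = (\<Prod>i=1..n. 1 - t ^ 2 * q ^ (4 * i - 2)) *
         (\<Sum>\<pi>\<in>signed_perms n. t ^ fdes n \<pi> * q ^ (2 * fmaj n \<pi>) * x ^ (2 * neg n \<pi>))"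
    using sum_sign_length_B[OF assms, of "\<lambda>_. UNIV" "\<lambda>_. UNIV" t q "\<lambda>_. x"]
    unfolding restricted_signed_perms_UNIV const by (simp add: neg_def)
  show "(\<Sum>\<pi>\<in>signed_perms (2 * n).
         (-1) ^ inversions (2 * n) (\<lambda>i. \<bar>\<pi> i\<bar>) * t ^ fdes (2 * n) \<pi> * q ^ fmaj (2 * n) \<pi>
           * x ^ neg (2 * n) \<pi>)
       = (\<Prod>i=1..n. 1 - t ^ 2 * q ^ (4 * i - 2)) *
         (\<Sum>\<pi>\<in>signed_perms n. t ^ fdes n \<pi> * q ^ (2 * fmaj n \<pi>) * x ^ (2 * neg n \<pi>))"
    using sum_sign_abs[OF assms, of "\<lambda>_. UNIV" "\<lambda>_. UNIV" t q "\<lambda>_. x"]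
    unfolding restricted_signed_perms_UNIV const by (simp add: neg_def)
qed (simp_all add: sign_neg_power_fmaj[symmetric] ac_simps)

end
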